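(* Let $\nu\ge1$ and let $J$ be the Jacobi matrix on $\ell^2(\mathbb{Z}^\nu)$ given by $$(Ju)(n)=\sum_{|m-n|=1}a_{(n,m)}u(m)+b_nu(n),$$ where the real numbers $b_n$ are indexed by $n\in\mathbb{Z}^\nu$ and the real numbers $a_{(n,m)}$ by bonds, i.e. unordered pairs $\{m,n\}$ with $|m-n|=1$. Suppose $$\sup_{|m-n|=1}\bigl(|a_{(n,m)}|+|a_{(n,m)}|^{-1}\bigr)+\sup_n|b_n|<\infty .$$ For $e\in S^{\nu-1}$ let $\mathcal{L}_e$ denote the set of limit points of $J$ in direction $e$. Then $$\sigma_{\mathrm{ess}}(J)=\overline{\bigcup_{e\in S^{\nu-1}}\ \bigcup_{\tilde J\in\mathcal{L}_e}\sigma(\tilde J)}.$$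
   Context: $S^{\nu-1}$ is the unit sphere in $\mathbb{R}^\nu$. A Jacobi matrix $\tilde J$ on $\ell^2(\mathbb{Z}^\nu)$ of the same form, with parameters $\tilde a_{(k,\ell)},\tilde b_\ell$, is a limit point of $J$ in direction $e\in S^{\nu-1}$ if there are points $n_j\in\mathbb{Z}^\nu$ with $|n_j|\to\infty$ and $n_j/|n_j|\to e$ such that for all $\ell\in\mathbb{Z}^\nu$ and all bonds $(k,\ell)$ one has $b_{n_j+\ell}\to\tilde b_\ell$ and $a_{(n_j+\ell,\,n_j+k)}\to\tilde a_{(k,\ell)}$ as $j\to\infty$. $\sigma,\sigma_{\mathrm{ess}}$ denote spectrum and essential spectrum. *)

theory Defs
  imports "HOL-Analysis.Analysis"
begin

section \<open>Operators on the complex Hilbert space of square-summable functions\<close>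

text \<open>
  Operators are functions on \<^typ>\<open>'i \<Rightarrow> complex\<close> of which only the restriction to
  \<open>ell2\<close> matters.
\<close>

definition ell2 :: "('i \<Rightarrow> complex) set" where
  "ell2 = {u. (\<lambda>i. (cmod (u i))\<^sup>2) summable_on UNIV}"

definition ell2_norm :: "('i \<Rightarrow> complex) \<Rightarrow> real" where
  "ell2_norm u = sqrt (\<Sum>\<^sub>\<infinity>i. (cmod (u i))\<^sup>2)"

definition bounded_operator :: "(('i \<Rightarrow> complex) \<Rightarrow> ('i \<Rightarrow> complex)) \<Rightarrow> bool" where
  "bounded_operator T \<longleftrightarrow>
     (\<forall>u\<in>ell2. T u \<in> ell2) \<and>
     (\<forall>u\<in>ell2. \<forall>v\<in>ell2. T (\<lambda>i. u i + v i) = (\<lambda>i. T u i + T v i)) \<and>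
     (\<forall>c. \<forall>u\<in>ell2. T (\<lambda>i. c * u i) = (\<lambda>i. c * T u i)) \<and>
     (\<exists>C. \<forall>u\<in>ell2. ell2_norm (T u) \<le> C * ell2_norm u)"

definition shift_by :: "(('i \<Rightarrow> complex) \<Rightarrow> ('i \<Rightarrow> complex)) \<Rightarrow> complex
    \<Rightarrow> ('i \<Rightarrow> complex) \<Rightarrow> ('i \<Rightarrow> complex)" where
  "shift_by T z u = (\<lambda>i. T u i - z * u i)"

definition invertible_operator :: "(('i \<Rightarrow> complex) \<Rightarrow> ('i \<Rightarrow> complex)) \<Rightarrow> bool" where
  "invertible_operator T \<longleftrightarrow>
     (\<exists>S. bounded_operator S \<and> (\<forall>u\<in>ell2. S (T u) = u \<and> T (S u) = u))"

definition spectrum :: "(('i \<Rightarrow> complex) \<Rightarrow> ('i \<Rightarrow> complex)) \<Rightarrow> complex set" where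
  "spectrum T = {z. \<not> invertible_operator (shift_by T z)}"

definition ell2_closed :: "('i \<Rightarrow> complex) set \<Rightarrow> bool" where
  "ell2_closed V \<longleftrightarrow>
     (\<forall>v w. (\<forall>k::nat. v k \<in> V) \<longrightarrow> w \<in> ell2 \<longrightarrow>
        (\<lambda>k. ell2_norm (\<lambda>i. v k i - w i)) \<longlonglongrightarrow> 0 \<longrightarrow> w \<in> V)"

text \<open>
  Being contained in the linear span of finitely many vectors; for subspaces this is finite
  dimension.
\<close>

definition finite_dimensional :: "('i \<Rightarrow> complex) set \<Rightarrow> bool" where
  "finite_dimensional V \<longleftrightarrow>
     (\<exists>B\<subseteq>ell2. finite B \<and> (\<forall>u\<in>V. \<exists>c. u = (\<lambda>i. \<Sum>w\<in>B. c w * w i)))"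

definition finite_codimensional :: "('i \<Rightarrow> complex) set \<Rightarrow> bool" where
  "finite_codimensional V \<longleftrightarrow>
     (\<exists>B\<subseteq>ell2. finite B \<and>
        (\<forall>u\<in>ell2. \<exists>v\<in>V. \<exists>c. u = (\<lambda>i. v i + (\<Sum>w\<in>B. c w * w i))))"

definition fredholm :: "(('i \<Rightarrow> complex) \<Rightarrow> ('i \<Rightarrow> complex)) \<Rightarrow> bool" where
  "fredholm T \<longleftrightarrow>
     bounded_operator T \<and>
     finite_dimensional {u \<in> ell2. T u = (\<lambda>i. 0)} \<and>
     ell2_closed (T ` ell2) \<and>
     finite_codimensional (T ` ell2)"

text \<open>
  The Fredholm essential spectrum; for self-adjoint operators all the usual definitions agree
  with it, in particular the spectrum without the isolated eigenvalues of finite multiplicity.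
\<close>

definition essential_spectrum :: "(('i \<Rightarrow> complex) \<Rightarrow> ('i \<Rightarrow> complex)) \<Rightarrow> complex set" where
  "essential_spectrum T = {z. \<not> fredholm (shift_by T z)}"


section \<open>Jacobi matrices on the integer lattice\<close>

definition lattice_vec :: "int ^ 'n \<Rightarrow> real ^ 'n" where
  "lattice_vec n = (\<chi> i. real_of_int (n $ i))"

definition adjacent :: "int ^ 'n \<Rightarrow> int ^ 'n \<Rightarrow> bool" where
  "adjacent m n \<longleftrightarrow> norm (lattice_vec (m - n)) = 1"

text \<open>The sum defining a Jacobi matrix has finitely many terms:\<close>

lemma finite_adjacent: "finite {m. adjacent m n}"
proof -
  let ?F = "{f :: 'a \<Rightarrow> int. \<forall>i. f i \<in> {n $ i - 1..n $ i + 1}}"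
  have "?F = PiE UNIV (\<lambda>i. {n $ i - 1..n $ i + 1})"
    by (auto simp: PiE_def Pi_def extensional_def)
  then have "finite ?F"
    by (simp add: finite_PiE)
  moreover have "{m. adjacent m n} \<subseteq> vec_lambda ` ?F"
  proof
    fix m assume "m \<in> {m. adjacent m n}"
    then have nrm: "norm (lattice_vec (m - n)) = 1"
      by (simp add: adjacent_def)
    have "m $ i \<in> {n $ i - 1..n $ i + 1}" for i
    proof -
      have "\<bar>real_of_int (m $ i - n $ i)\<bar> \<le> 1"
        using component_le_norm_cart[of "lattice_vec (m - n)" i] nrm
        by (simp add: lattice_vec_def)
      then have "\<bar>m $ i - n $ i\<bar> \<le> 1"
        by linarith
      then show ?thesis
        by auto
    qed
    then have "vec_nth m \<in> ?F"
      by blast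
    moreover have "m = vec_lambda (vec_nth m)"
      by simp
    ultimately show "m \<in> vec_lambda ` ?F"
      by blast
  qed
  ultimately show ?thesis
    by (meson finite_imageI finite_subset)
qed

text \<open>
  The off-diagonal coefficients are indexed by unordered pairs of lattice points; their values
  on sets that are not bonds play no role.
\<close>

definition jacobi :: "((int ^ 'n) set \<Rightarrow> real) \<Rightarrow> (int ^ 'n \<Rightarrow> real)
    \<Rightarrow> (int ^ 'n \<Rightarrow> complex) \<Rightarrow> (int ^ 'n \<Rightarrow> complex)" where
  "jacobi a b u =
     (\<lambda>n. (\<Sum>m | adjacent m n. complex_of_real (a {n, m}) * u m) + complex_of_real (b n) * u n)"

definition limit_points :: "((int ^ 'n) set \<Rightarrow> real) \<Rightarrow> (int ^ 'n \<Rightarrow> real) \<Rightarrow> real ^ 'n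
    \<Rightarrow> ((int ^ 'n \<Rightarrow> complex) \<Rightarrow> (int ^ 'n \<Rightarrow> complex)) set" where
  "limit_points a b e =
     {jacobi a' b' | a' b'.
        \<exists>p :: nat \<Rightarrow> int ^ 'n.
          filterlim (\<lambda>j. norm (lattice_vec (p j))) at_top sequentially \<and>
          (\<lambda>j. lattice_vec (p j) /\<^sub>R norm (lattice_vec (p j))) \<longlonglongrightarrow> e \<and>
          (\<forall>l. (\<lambda>j. b (p j + l)) \<longlonglongrightarrow> b' l) \<and>
          (\<forall>k l. adjacent k l \<longrightarrow> (\<lambda>j. a {p j + l, p j + k}) \<longlonglongrightarrow> a' {k, l})}"

end

theory Submission
  imports Defs "HOL-Complex_Analysis.Great_Picard"
begin

text \<open>
  A number \<open>z\<close> lies in the essential spectrum of \<open>J\<close> iff \<open>J - z\<close> has approximate null vectors of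
  finite support arbitrarily far out. One direction is a gliding-hump argument. For the other, if
  there are none, then \<open>J - z\<close> is bounded below on the vectors vanishing on some finite set \<open>F\<close>,
  so \<open>J - z + \<i> P\<^sub>F\<close> is invertible and \<open>J - z\<close> is a finite-rank perturbation of it.
  Cutting such approximate null vectors off to translates of a large cube costs little, because the
  boundary of the cube is small compared with its volume. Translating the pieces back to the origin
  and passing to a subsequence yields a limit point of \<open>J\<close> with an approximate null vector, hence
  with spectrum near \<open>z\<close>. Conversely, truncated approximate eigenvectors of a limit point can be
  moved to infinity to serve for \<open>J\<close>.
\<close>


section \<open>The Hilbert space of square-summable functions\<close>

text \<open>The danger in passing to a limit is loss of mass: translates of an arbitrary singular
  sequence may spread out and converge pointwise to zero. Localization therefore fixes one finite
  set \<open>Q\<close> that depends on the permitted error but not on how far out the vectors live.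
  For pieces supported in translates of \<open>Q\<close>, pointwise convergence is norm convergence,
  so the limit still has norm 1. As \<open>Q\<close> depends on the error, a single limit point only
  yields spectrum within \<epsilon> of z, which is where the closure comes from.

  Symmetry lets lower bounds decide everything: \<open>J - z\<close> and its adjoint have equal
  norms on every vector, so being bounded below already means being invertible. For non-real z this
  always happens, and neither side of the equality contains z.

  The perturbation on F carries the coefficient \<i> because pairing with \<i> x annihilates the
  symmetric part and isolates the norm of x on F. The adjoint has the same form with the opposite
  sign, so it obeys the same bound, and surjectivity follows.\<close>

lemma ell2_comparison:
  assumes "f summable_on UNIV" "\<And>i. (cmod (u i))\<^sup>2 \<le> f i"
  shows "u \<in> ell2"
  unfolding ell2_def using summable_on_comparison_test[OF assms(1)] assms(2) by simp

lemma ell2_add: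
  assumes "u \<in> ell2" "v \<in> ell2"
  shows "(\<lambda>i. u i + v i) \<in> ell2"
proof (rule ell2_comparison)
  show "(\<lambda>i. 2 * (cmod (u i))\<^sup>2 + 2 * (cmod (v i))\<^sup>2) summable_on UNIV"
    using assms by (intro summable_on_add summable_on_cmult_right) (auto simp: ell2_def)
  show "(cmod (u i + v i))\<^sup>2 \<le> 2 * (cmod (u i))\<^sup>2 + 2 * (cmod (v i))\<^sup>2" for i
  proof -
    have "(cmod (u i + v i))\<^sup>2 \<le> (cmod (u i) + cmod (v i))\<^sup>2"
      by (intro power_mono norm_triangle_ineq) auto
    also have "\<dots> \<le> 2 * (cmod (u i))\<^sup>2 + 2 * (cmod (v i))\<^sup>2"
      using zero_le_power2[of "cmod (u i) - cmod (v i)"] by (simp add: power2_sum power2_diff)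
    finally show ?thesis .
  qed
qed

lemma ell2_mult:
  assumes "u \<in> ell2" "\<And>i. cmod (w i) \<le> C"
  shows "(\<lambda>i. w i * u i) \<in> ell2"
proof (rule ell2_comparison)
  show "(\<lambda>i. C\<^sup>2 * (cmod (u i))\<^sup>2) summable_on UNIV"
    using assms(1) by (intro summable_on_cmult_right) (auto simp: ell2_def)
  show "(cmod (w i * u i))\<^sup>2 \<le> C\<^sup>2 * (cmod (u i))\<^sup>2" for i
    unfolding norm_mult power_mult_distrib
    by (intro mult_right_mono power_mono assms) auto
qed

text \<open>A type is used so that limits, closed sets, series and contractions are available
  through type classes. Its vector space structure is real only; complex linearity is tracked
  separately, as commutation with \<open>cscale\<close>.\<close>

typedef 'i l2 = "ell2 :: ('i \<Rightarrow> complex) set"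
  morphisms coord Abs_l2
proof
  show "(\<lambda>_. 0) \<in> ell2"
    by (simp add: ell2_def)
qed

setup_lifting type_definition_l2

lemma summable_inner_ell2:
  assumes "u \<in> ell2" "v \<in> ell2"
  shows "(\<lambda>i. u i \<bullet> v i) summable_on UNIV"
proof -
  have "(\<lambda>i. norm (u i \<bullet> v i)) summable_on UNIV"
  proof (rule summable_on_comparison_test)
    show "(\<lambda>i. (cmod (u i))\<^sup>2 + (cmod (v i))\<^sup>2) summable_on UNIV"
      using assms by (intro summable_on_add) (auto simp: ell2_def)
    fix i
    have "norm (u i \<bullet> v i) \<le> cmod (u i) * cmod (v i)"
      using Cauchy_Schwarz_ineq2 by simp
    also have "\<dots> \<le> (cmod (u i))\<^sup>2 + (cmod (v i))\<^sup>2"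
      using sum_squares_bound[of "cmod (u i)" "cmod (v i)"]
        mult_nonneg_nonneg[OF norm_ge_zero[of "u i"] norm_ge_zero[of "v i"]]
      unfolding mult.assoc by linarith
    finally show "norm (u i \<bullet> v i) \<le> (cmod (u i))\<^sup>2 + (cmod (v i))\<^sup>2" .
  qed auto
  then show ?thesis
    by (rule abs_summable_summable)
qed

instantiation l2 :: (type) real_inner
begin

lift_definition zero_l2 :: "'a l2" is "\<lambda>_. 0"
  by (simp add: ell2_def)

lift_definition plus_l2 :: "'a l2 \<Rightarrow> 'a l2 \<Rightarrow> 'a l2" is "\<lambda>u v i. u i + v i"
  by (rule ell2_add)

lift_definition uminus_l2 :: "'a l2 \<Rightarrow> 'a l2" is "\<lambda>u i. - u i"
  by (simp add: ell2_def)

lift_definition minus_l2 :: "'a l2 \<Rightarrow> 'a l2 \<Rightarrow> 'a l2" is "\<lambda>u v i. u i - v i"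
proof -
  fix u v :: "'a \<Rightarrow> complex"
  assume "u \<in> ell2" "v \<in> ell2"
  then show "(\<lambda>i. u i - v i) \<in> ell2"
    using ell2_add[of u "\<lambda>i. - v i"] by (simp add: ell2_def)
qed

lift_definition scaleR_l2 :: "real \<Rightarrow> 'a l2 \<Rightarrow> 'a l2" is "\<lambda>r u i. r *\<^sub>R u i"
proof -
  fix r :: real and u :: "'a \<Rightarrow> complex"
  assume "u \<in> ell2"
  then show "(\<lambda>i. r *\<^sub>R u i) \<in> ell2"
    using ell2_mult[of u "\<lambda>_. of_real r" "\<bar>r\<bar>"] by (simp add: scaleR_conv_of_real)
qed

text \<open>On complex numbers \<open>\<bullet>\<close> is the real part of the Hermitian product,
  so this is the real part of the usual inner product and induces the same norm.\<close>

lift_definition inner_l2 :: "'a l2 \<Rightarrow> 'a l2 \<Rightarrow> real" is "\<lambda>u v. \<Sum>\<^sub>\<infinity>i. u i \<bullet> v i" .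

definition norm_l2 :: "'a l2 \<Rightarrow> real" where
  "norm_l2 u = sqrt (u \<bullet> u)"

definition sgn_l2 :: "'a l2 \<Rightarrow> 'a l2" where
  "sgn_l2 u = inverse (norm u) *\<^sub>R u"

definition dist_l2 :: "'a l2 \<Rightarrow> 'a l2 \<Rightarrow> real" where
  "dist_l2 u v = norm (u - v)"

definition uniformity_l2 :: "('a l2 \<times> 'a l2) filter" where
  "uniformity_l2 = (INF e\<in>{0<..}. principal {(u, v). dist u v < e})"

definition open_l2 :: "'a l2 set \<Rightarrow> bool" where
  "open_l2 U \<longleftrightarrow> (\<forall>u\<in>U. \<forall>\<^sub>F (u', v) in uniformity. u' = u \<longrightarrow> v \<in> U)"

instance
proof
  fix x y z :: "'a l2" and r s :: real
  show "x + y + z = x + (y + z)" by transfer (simp add: add.assoc)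
  show "x + y = y + x" by transfer (simp add: add.commute)
  show "0 + x = x" by transfer simp
  show "- x + x = 0" by transfer simp
  show "x - y = x + - y" by transfer simp
  show "r *\<^sub>R (x + y) = r *\<^sub>R x + r *\<^sub>R y" by transfer (simp add: scaleR_add_right)
  show "(r + s) *\<^sub>R x = r *\<^sub>R x + s *\<^sub>R x" by transfer (simp add: scaleR_add_left)
  show "r *\<^sub>R s *\<^sub>R x = (r * s) *\<^sub>R x" by transfer simp
  show "1 *\<^sub>R x = x" by transfer simp
  show "x \<bullet> y = y \<bullet> x" by transfer (simp add: inner_commute)
  show "(x + y) \<bullet> z = x \<bullet> z + y \<bullet> z"
    by transfer (simp add: inner_add_left infsum_add summable_inner_ell2)
  show "r *\<^sub>R x \<bullet> y = r * (x \<bullet> y)"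
    by transfer (simp add: infsum_cmult_right summable_inner_ell2)
  show "0 \<le> x \<bullet> x" by transfer (simp add: infsum_nonneg)
  show "x \<bullet> x = 0 \<longleftrightarrow> x = 0"
  proof transfer
    fix u :: "'a \<Rightarrow> complex"
    assume u: "u \<in> ell2"
    show "(\<Sum>\<^sub>\<infinity>i. u i \<bullet> u i) = 0 \<longleftrightarrow> u = (\<lambda>_. 0)"
    proof
      assume "(\<Sum>\<^sub>\<infinity>i. u i \<bullet> u i) = 0"
      then have "u i \<bullet> u i = 0" for i
        using nonneg_infsum_le_0D[of "\<lambda>i. u i \<bullet> u i" UNIV i] summable_inner_ell2[OF u u] by simp
      then show "u = (\<lambda>_. 0)" by auto
    qed simp
  qed
qed (auto simp: norm_l2_def sgn_l2_def dist_l2_def uniformity_l2_def open_l2_def)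

end

lemma coord_simps [simp]:
  "coord 0 i = 0" "coord (u + v) i = coord u i + coord v i"
  "coord (u - v) i = coord u i - coord v i" "coord (- u) i = - coord u i"
  "coord (r *\<^sub>R u) i = r *\<^sub>R coord u i"
  by (transfer; simp)+

lemma coord_sum: "coord (\<Sum>x\<in>A. f x) i = (\<Sum>x\<in>A. coord (f x) i)"
  by (induction A rule: infinite_finite_induct) auto

lemma l2_eqI: "(\<And>i. coord u i = coord v i) \<Longrightarrow> u = v"
  by (metis coord_inject ext)

lemma inner_l2_eq: "u \<bullet> v = (\<Sum>\<^sub>\<infinity>i. coord u i \<bullet> coord v i)"
  by transfer simp

lemma norm_l2_sq: "(norm u)\<^sup>2 = (\<Sum>\<^sub>\<infinity>i. (cmod (coord u i))\<^sup>2)"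
  by (simp add: power2_norm_eq_inner inner_l2_eq)

lemma norm_eq_ell2_norm: "norm u = ell2_norm (coord u)"
  unfolding ell2_norm_def norm_l2_sq[symmetric] by simp

lemma summable_coord_sq: "(\<lambda>i. (cmod (coord u i))\<^sup>2) summable_on A"
  using coord[of u] by (intro summable_on_subset[of _ UNIV A]) (auto simp: ell2_def)

lemma sum_coord_sq_le: "finite F \<Longrightarrow> (\<Sum>i\<in>F. (cmod (coord u i))\<^sup>2) \<le> (norm u)\<^sup>2"
  unfolding norm_l2_sq by (intro finite_sum_le_infsum summable_coord_sq) auto

lemma cmod_coord_le: "cmod (coord u i) \<le> norm u"
  using sum_coord_sq_le[of "{i}" u] by (simp add: power2_le_iff_abs_le)

lemma bounded_linear_coord: "bounded_linear (\<lambda>u. coord u i)"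
  by (rule bounded_linear_intro[where K = 1]) (auto simp: cmod_coord_le)

lemma norm_l2_finite_support:
  assumes "finite F" "\<And>i. i \<notin> F \<Longrightarrow> coord u i = 0"
  shows "(norm u)\<^sup>2 = (\<Sum>i\<in>F. (cmod (coord u i))\<^sup>2)"
  unfolding norm_l2_sq using assms
  by (subst infsum_finite[symmetric], simp, intro infsum_cong_neutral) auto

lemma norm_l2_leI:
  assumes "\<And>F. finite F \<Longrightarrow> (\<Sum>i\<in>F. (cmod (coord u i))\<^sup>2) \<le> C\<^sup>2" "0 \<le> C"
  shows "norm u \<le> C"
proof -
  have "(norm u)\<^sup>2 \<le> C\<^sup>2"
    unfolding norm_l2_sq using assms by (intro infsum_le_finite_sums summable_coord_sq) auto
  then show ?thesis
    using assms(2) by (rule power2_le_imp_le)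
qed

text \<open>Coordinates of a Cauchy sequence converge. Bounds on finite partial sums survive this
  pointwise limit, which gives both square-summability of the limit and convergence in norm.\<close>

instance l2 :: (type) complete_space
proof
  fix X :: "nat \<Rightarrow> 'a l2"
  assume X: "Cauchy X"
  have "Cauchy (\<lambda>n. coord (X n) i)" for i
    using bounded_linear.Cauchy[OF bounded_linear_coord X] .
  then have "\<forall>i. \<exists>l. (\<lambda>n. coord (X n) i) \<longlonglongrightarrow> l"
    by (simp add: Cauchy_convergent_iff convergent_def)
  then obtain w where w: "\<And>i. (\<lambda>n. coord (X n) i) \<longlonglongrightarrow> w i"
    by metis
  have fin: "(\<Sum>i\<in>F. (cmod (w i - coord (X m) i))\<^sup>2) \<le> e\<^sup>2"
    if "finite F" "\<And>n. n \<ge> m \<Longrightarrow> dist (X n) (X m) \<le> e" for F m e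
  proof (rule Lim_bounded)
    show "(\<lambda>n. \<Sum>i\<in>F. (cmod (coord (X n) i - coord (X m) i))\<^sup>2)
        \<longlonglongrightarrow> (\<Sum>i\<in>F. (cmod (w i - coord (X m) i))\<^sup>2)"
      by (intro tendsto_intros w)
    show "\<forall>n\<ge>m. (\<Sum>i\<in>F. (cmod (coord (X n) i - coord (X m) i))\<^sup>2) \<le> e\<^sup>2"
    proof (intro allI impI)
      fix n assume "m \<le> n"
      then have "(norm (X n - X m))\<^sup>2 \<le> e\<^sup>2"
        using that(2) by (intro power_mono) (auto simp: dist_norm)
      then show "(\<Sum>i\<in>F. (cmod (coord (X n) i - coord (X m) i))\<^sup>2) \<le> e\<^sup>2"
        using sum_coord_sq_le[OF that(1), of "X n - X m"] by simp
    qed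
  qed
  have cau: "\<exists>m. \<forall>k\<ge>m. \<forall>n\<ge>k. dist (X n) (X k) \<le> e" if e: "e > 0" for e
  proof -
    obtain m where "\<forall>k\<ge>m. \<forall>n\<ge>m. dist (X k) (X n) < e"
      using X e unfolding Cauchy_def by blast
    then show ?thesis
      by (intro exI[of _ m]) (force intro: less_imp_le)
  qed
  obtain m where m: "\<And>n. n \<ge> m \<Longrightarrow> dist (X n) (X m) \<le> 1"
    using cau[of 1] by auto
  have "(\<lambda>i. w i - coord (X m) i) \<in> ell2"
    unfolding ell2_def mem_Collect_eq
    by (intro nonneg_bdd_above_summable_on bdd_aboveI[where M = "1\<^sup>2"])
       (use fin[OF _ m] in auto)
  then have "w \<in> ell2"
    using ell2_add[OF _ coord[of "X m"]] by fastforce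
  then have cw: "coord (Abs_l2 w) = w"
    by (simp add: Abs_l2_inverse)
  have "X \<longlonglongrightarrow> Abs_l2 w"
  proof (rule metric_LIMSEQ_I)
    fix e :: real assume "e > 0"
    then obtain m where m: "\<And>k n. m \<le> k \<Longrightarrow> k \<le> n \<Longrightarrow> dist (X n) (X k) \<le> e / 2"
      using cau[of "e / 2"] by auto
    have "norm (Abs_l2 w - X k) \<le> e / 2" if "m \<le> k" for k
      using fin[OF _ m[OF that]] \<open>e > 0\<close> by (intro norm_l2_leI) (auto simp: cw)
    then show "\<exists>no. \<forall>n\<ge>no. dist (X n) (Abs_l2 w) < e"
      using \<open>e > 0\<close> by (intro exI[of _ m]) (force simp: dist_norm norm_minus_commute)
  qed
  then show "convergent X"
    by (auto simp: convergent_def)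
qed

instance l2 :: (type) banach ..

section \<open>Multiplication, restriction and translation operators\<close>

text \<open>For unbounded \<open>w\<close> the product may leave \<open>ell2\<close>, where
  \<open>Abs_l2\<close> is unspecified; hence the premise \<open>bounded (range w)\<close> in what
  follows.\<close>

definition mult :: "('i \<Rightarrow> complex) \<Rightarrow> 'i l2 \<Rightarrow> 'i l2" where
  "mult w u = Abs_l2 (\<lambda>i. w i * coord u i)"

lemma coord_mult:
  assumes "bounded (range w)"
  shows "coord (mult w u) i = w i * coord u i"
proof -
  obtain C where "\<And>i. cmod (w i) \<le> C"
    using assms by (auto simp: bounded_iff)
  then show ?thesis
    unfolding mult_def using ell2_mult[OF coord] by (subst Abs_l2_inverse) auto
qed

lemma norm_mult_le:
  assumes "\<And>i. cmod (w i) \<le> C"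
  shows "norm (mult w u) \<le> C * norm u"
proof -
  have C: "0 \<le> C"
    using assms[of undefined] by (rule order_trans[OF norm_ge_zero])
  have w: "bounded (range w)"
    using assms by (auto simp: bounded_iff)
  show ?thesis
  proof (rule norm_l2_leI)
    fix F :: "'a set" assume F: "finite F"
    have "(\<Sum>i\<in>F. (cmod (coord (mult w u) i))\<^sup>2) \<le> (\<Sum>i\<in>F. C\<^sup>2 * (cmod (coord u i))\<^sup>2)"
      unfolding coord_mult[OF w] norm_mult power_mult_distrib
      by (intro sum_mono mult_right_mono power_mono assms) auto
    also have "\<dots> \<le> C\<^sup>2 * (norm u)\<^sup>2"
      unfolding sum_distrib_left[symmetric] by (intro mult_left_mono sum_coord_sq_le F) auto
    finally show "(\<Sum>i\<in>F. (cmod (coord (mult w u) i))\<^sup>2) \<le> (C * norm u)\<^sup>2"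
      by (simp add: power_mult_distrib)
  qed (simp add: C)
qed

lemma bounded_linear_mult:
  assumes "bounded (range w)"
  shows "bounded_linear (mult w)"
proof -
  obtain C where "\<And>i. cmod (w i) \<le> C"
    using assms by (auto simp: bounded_iff)
  then show ?thesis
    by (intro bounded_linear_intro[where K = C])
       (auto intro!: l2_eqI simp: coord_mult[OF assms] algebra_simps norm_mult_le)
qed

lemma inner_mult:
  assumes "bounded (range w)"
  shows "mult w u \<bullet> v = u \<bullet> mult (\<lambda>i. cnj (w i)) v"
proof -
  have "bounded (range (\<lambda>i. cnj (w i)))"
    using assms by (auto simp: bounded_iff)
  then show ?thesis
    unfolding inner_l2_eq coord_mult[OF assms] by (simp add: coord_mult inner_complex_def algebra_simps)
qed

text \<open>Complex scalars act as multiplication by constant functions, since \<open>scaleR\<close>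
  only provides the real ones.\<close>

abbreviation cscale :: "complex \<Rightarrow> 'i l2 \<Rightarrow> 'i l2" where
  "cscale c \<equiv> mult (\<lambda>_. c)"

lemma coord_cscale [simp]: "coord (cscale c u) i = c * coord u i"
  by (simp add: coord_mult)

lemma norm_cscale: "norm (cscale c u) = cmod c * norm u"
proof -
  have "(norm (cscale c u))\<^sup>2 = (cmod c * norm u)\<^sup>2"
    unfolding norm_l2_sq power_mult_distrib
    by (simp add: norm_mult power_mult_distrib infsum_cmult_right summable_coord_sq)
  then show ?thesis
    by (simp add: power2_eq_iff_nonneg)
qed

definition restr :: "'i set \<Rightarrow> 'i l2 \<Rightarrow> 'i l2" where
  "restr F = mult (indicator F)"

lemma coord_restr [simp]: "coord (restr F u) i = (if i \<in> F then coord u i else 0)"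
  unfolding restr_def by (subst coord_mult) (auto simp: bounded_iff indicator_def intro: exI[of _ 1])

lemma bounded_linear_restr: "bounded_linear (restr F)"
  unfolding restr_def by (rule bounded_linear_mult) (auto simp: bounded_iff indicator_def intro: exI[of _ 1])

lemma restr_approx:
  assumes "e > 0"
  obtains F where "finite F" "norm (u - restr F u) < e"
proof -
  have "((\<lambda>i. (cmod (coord u i))\<^sup>2) has_sum (norm u)\<^sup>2) UNIV"
    unfolding norm_l2_sq by (simp add: summable_coord_sq)
  then obtain F where F: "finite F" "dist (\<Sum>i\<in>F. (cmod (coord u i))\<^sup>2) ((norm u)\<^sup>2) \<le> (e/2)\<^sup>2"
    using has_sum_finite_approximation[of _ _ _ "(e/2)\<^sup>2"] assms by (metis half_gt_zero zero_less_power)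
  have "norm (u - restr F u) \<le> e/2"
  proof (rule norm_l2_leI)
    fix G :: "'a set" assume G: "finite G"
    have "(\<Sum>i\<in>G. (cmod (coord (u - restr F u) i))\<^sup>2) = (\<Sum>i\<in>G-F. (cmod (coord u i))\<^sup>2)"
      by (intro sum.mono_neutral_cong_right G) auto
    also have "\<dots> = (\<Sum>i\<in>G\<union>F. (cmod (coord u i))\<^sup>2) - (\<Sum>i\<in>F. (cmod (coord u i))\<^sup>2)"
      using G F(1) by (subst Un_Diff_cancel2[symmetric], subst sum.union_disjoint) auto
    also have "\<dots> \<le> (norm u)\<^sup>2 - (\<Sum>i\<in>F. (cmod (coord u i))\<^sup>2)"
      using G F(1) by (intro diff_right_mono sum_coord_sq_le) auto
    also have "\<dots> \<le> (e/2)\<^sup>2"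
      using F(2) by (simp add: dist_real_def)
    finally show "(\<Sum>i\<in>G. (cmod (coord (u - restr F u) i))\<^sup>2) \<le> (e/2)\<^sup>2" .
  qed (use assms in simp)
  with F(1) assms show thesis
    by (intro that[of F]) auto
qed

text \<open>The sign is such that a vector living near \<open>p\<close> is brought to the origin,
  and \<open>transl (- p)\<close> sends it back.\<close>

lift_definition transl :: "'i::ab_group_add \<Rightarrow> 'i l2 \<Rightarrow> 'i l2" is "\<lambda>p u n. u (n + p)"
proof -
  fix p :: 'i and u :: "'i \<Rightarrow> complex"
  have "bij (\<lambda>n. n + p)"
    by (rule bij_betw_byWitness[where f' = "\<lambda>n. n - p"]) auto
  then show "u \<in> ell2 \<Longrightarrow> (\<lambda>n. u (n + p)) \<in> ell2"
    unfolding ell2_def using summable_on_reindex_bij_betw[of "\<lambda>n. n + p" UNIV UNIV "\<lambda>i. (cmod (u i))\<^sup>2"]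
    by simp
qed

lemma coord_transl [simp]: "coord (transl p u) n = coord u (n + p)"
  by transfer simp

lemma inner_transl: "transl p u \<bullet> v = u \<bullet> transl (- p) v"
proof -
  have "bij (\<lambda>n. n + p)"
    by (rule bij_betw_byWitness[where f' = "\<lambda>n. n - p"]) auto
  then show ?thesis
    unfolding inner_l2_eq
    using infsum_reindex_bij_betw[of "\<lambda>n. n + p" UNIV UNIV "\<lambda>n. coord u n \<bullet> coord v (n - p)"]
    by simp
qed

lemma transl_transl [simp]: "transl p (transl q u) = transl (p + q) u"
  by (rule l2_eqI) (simp add: algebra_simps)

lemma transl_0 [simp]: "transl 0 u = u"
  by (rule l2_eqI) simp

lemma norm_transl [simp]: "norm (transl p u) = norm u"
  by (simp add: norm_eq_sqrt_inner inner_transl)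

lemma bounded_linear_transl: "bounded_linear (transl p)"
  by (rule bounded_linear_intro[where K = 1]) (auto intro: l2_eqI)


section \<open>Operators that are bounded below\<close>

definition bounded_below :: "('a::real_normed_vector \<Rightarrow> 'b::real_normed_vector) \<Rightarrow> bool" where
  "bounded_below G \<longleftrightarrow> (\<exists>c>0. \<forall>x. c * norm x \<le> norm (G x))"

text \<open>
  For small \<open>t > 0\<close> the map \<open>x \<mapsto> x - t A'(A x - y)\<close> is a contraction, and its fixed point solves
  \<open>A x = y\<close> because \<open>A'\<close> is injective.
\<close>

lemma bounded_below_imp_surj:
  fixes A A' :: "'a::{real_inner,complete_space} \<Rightarrow> 'a"
  assumes "bounded_linear A" "bounded_linear A'" and adj: "\<And>x y. A x \<bullet> y = x \<bullet> A' y"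
    and "bounded_below A" "bounded_below A'"
  shows "surj A"
proof -
  interpret A: bounded_linear A by fact
  interpret A': bounded_linear A' by fact
  obtain c where c: "c > 0" "\<And>x. c * norm x \<le> norm (A x)"
    using assms(4) by (auto simp: bounded_below_def)
  obtain c' where c': "c' > 0" "\<And>x. c' * norm x \<le> norm (A' x)"
    using assms(5) by (auto simp: bounded_below_def)
  obtain K0 where K0: "K0 > 0" "\<And>x. norm (A' x) \<le> norm x * K0"
    using A'.pos_bounded by blast
  \<comment> \<open>Enlarging the bound of \<open>A'\<close> to at least \<open>c\<close> makes
    \<open>1 - c\<^sup>2 / K\<^sup>2\<close> nonnegative. With step size
    \<open>1 / K\<^sup>2\<close> its square root \<open>q\<close> is the contraction factor: the
    square of the new distance is at most that of the old one, \<open>norm d\<close>, minus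
    \<open>(norm (A d))\<^sup>2 / K\<^sup>2\<close>.\<close>
  define K where "K = max K0 c"
  have K: "K > 0" "c \<le> K" "norm (A' x) \<le> K * norm x" for x
  proof -
    show "norm (A' x) \<le> K * norm x"
      using order_trans[OF K0(2), of x "norm x * K"] mult_left_mono[of K0 K "norm x"]
      by (simp add: K_def mult.commute)
  qed (use c K_def in auto)
  define q where "q = sqrt (1 - c\<^sup>2 / K\<^sup>2)"
  have cK: "0 < c\<^sup>2 / K\<^sup>2" "c\<^sup>2 / K\<^sup>2 \<le> 1"
    using c K by (auto simp: power_mono)
  have q: "0 \<le> q" "q < 1"
    using cK by (auto simp: q_def)
  have "\<exists>x. A x = y" for y
  proof -
    define f where "f x = x - (1 / K\<^sup>2) *\<^sub>R A' (A x - y)" for x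
    have contr: "dist (f x1) (f x2) \<le> q * dist x1 x2" for x1 x2
    proof -
      define d where "d = x1 - x2"
      have eq: "f x1 - f x2 = d - (1 / K\<^sup>2) *\<^sub>R A' (A d)"
        by (simp add: f_def d_def A.diff A'.diff algebra_simps)
      have "(norm (f x1 - f x2))\<^sup>2 = (norm d)\<^sup>2 - 2 / K\<^sup>2 * (norm (A d))\<^sup>2 + (norm (A' (A d)))\<^sup>2 / K\<^sup>2 / K\<^sup>2"
      proof -
        have dA: "d \<bullet> A' (A d) = A d \<bullet> A d" "A' (A d) \<bullet> d = A d \<bullet> A d"
          using adj[of d "A d"] by (simp_all add: inner_commute)
        show ?thesis
          unfolding eq power2_norm_eq_inner inner_diff_left inner_diff_right inner_scaleR_left
            inner_scaleR_right dA by (simp add: algebra_simps)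
      qed
      also have "(norm (A' (A d)))\<^sup>2 / K\<^sup>2 \<le> (norm (A d))\<^sup>2"
        using power_mono[OF K(3)[of "A d"], of 2] K(1) by (simp add: power_mult_distrib field_simps)
      then have "(norm d)\<^sup>2 - 2 / K\<^sup>2 * (norm (A d))\<^sup>2 + (norm (A' (A d)))\<^sup>2 / K\<^sup>2 / K\<^sup>2
          \<le> (norm d)\<^sup>2 - 2 / K\<^sup>2 * (norm (A d))\<^sup>2 + (norm (A d))\<^sup>2 / K\<^sup>2"
        by (intro add_left_mono divide_right_mono) auto
      also have "\<dots> = (norm d)\<^sup>2 - (norm (A d))\<^sup>2 / K\<^sup>2"
        by (simp add: field_simps)
      also have "\<dots> \<le> (norm d)\<^sup>2 - (c * norm d)\<^sup>2 / K\<^sup>2"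
        using c by (intro diff_left_mono divide_right_mono power_mono) auto
      also have "\<dots> = (q * norm d)\<^sup>2"
      proof -
        have "(q * norm d)\<^sup>2 = (1 - c\<^sup>2 / K\<^sup>2) * (norm d)\<^sup>2"
          using cK by (simp add: q_def power_mult_distrib)
        then show ?thesis
          by (simp add: power_mult_distrib left_diff_distrib)
      qed
      finally show ?thesis
        unfolding dist_norm d_def using q by (rule_tac power2_le_imp_le) (auto simp: d_def)
    qed
    obtain x where "f x = x"
      using ex1_implies_ex[OF banach_fix_type[OF q, of f]] contr by blast
    then have "A' (A x - y) = 0"
      using K(1) by (simp add: f_def)
    then show ?thesis
      using c'(2)[of "A x - y"] c'(1) by (auto simp: mult_le_0_iff)
  qed
  then show ?thesis
    by (metis surjI)
qed

text \<open>
  Let \<open>c\<close> be the infimum of \<open>\<parallel>S x\<parallel> / \<parallel>x\<parallel>\<close>. The operator \<open>B = S\<^sup>2 - c\<^sup>2\<close> is nonnegative, so that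
  \<open>\<parallel>B x\<parallel>\<^sup>2 \<le> K \<langle>B x, x\<rangle>\<close>; were both \<open>S - c\<close> and \<open>S + c\<close> bounded below, this would bound
  \<open>\<langle>B x, x\<rangle> = \<parallel>S x\<parallel>\<^sup>2 - c\<^sup>2 \<parallel>x\<parallel>\<^sup>2\<close> away from zero.
\<close>

lemma approx_kernel_imp_not_bounded_below:
  fixes S :: "'a::real_inner \<Rightarrow> 'a"
  assumes "bounded_linear S" and sym: "\<And>x y. S x \<bullet> y = x \<bullet> S y"
    and u: "u \<noteq> 0" "norm (S u) \<le> e * norm u"
  obtains t where "\<bar>t\<bar> \<le> e" "\<not> bounded_below (\<lambda>x. S x - t *\<^sub>R x)"
proof -
  interpret S: bounded_linear S by fact
  define R where "R = {norm (S x) / norm x | x. x \<noteq> 0}"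
  define c where "c = Inf R"
  have R0: "bdd_below R"
    by (rule bdd_belowI[of _ 0]) (auto simp: R_def)
  have Ru: "norm (S u) / norm u \<in> R"
    using u by (auto simp: R_def)
  have c0: "0 \<le> c"
    unfolding c_def using Ru by (intro cInf_greatest) (auto simp: R_def)
  have "c \<le> norm (S u) / norm u"
    unfolding c_def by (rule cInf_lower[OF Ru R0])
  also have "\<dots> \<le> e"
    using u by (simp add: divide_simps mult.commute)
  finally have ce: "c \<le> e" .
  have cS: "c * norm x \<le> norm (S x)" for x
  proof (cases "x = 0")
    case False
    then have "norm (S x) / norm x \<in> R" by (auto simp: R_def)
    then have "c \<le> norm (S x) / norm x"
      unfolding c_def by (rule cInf_lower[OF _ R0])
    then show ?thesis using False by (simp add: field_simps)
  qed auto
  have "\<not> (bounded_below (\<lambda>x. S x - c *\<^sub>R x) \<and> bounded_below (\<lambda>x. S x - (- c) *\<^sub>R x))"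
  proof
    assume "bounded_below (\<lambda>x. S x - c *\<^sub>R x) \<and> bounded_below (\<lambda>x. S x - (- c) *\<^sub>R x)"
    then obtain d1 d2 where d1: "d1 > 0" "\<And>x. d1 * norm x \<le> norm (S x - c *\<^sub>R x)"
      and d2: "d2 > 0" "\<And>x. d2 * norm x \<le> norm (S x + c *\<^sub>R x)"
      by (auto simp: bounded_below_def)
    define B where "B x = S (S x) - c\<^sup>2 *\<^sub>R x" for x
    have "bounded_linear (\<lambda>x. S (S x) - c\<^sup>2 *\<^sub>R x)"
      by (intro bounded_linear_sub bounded_linear_compose[OF assms(1) assms(1)] bounded_linear_scaleR_right)
    then interpret B: bounded_linear B
      unfolding B_def .
    obtain K where K: "K > 0" "\<And>x. norm (B x) \<le> norm x * K"
      using B.pos_bounded by blast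
    have Bsym: "B x \<bullet> y = x \<bullet> B y" for x y
      by (simp add: B_def inner_diff_left inner_diff_right sym)
    have Bxx: "B x \<bullet> x = (norm (S x))\<^sup>2 - c\<^sup>2 * (norm x)\<^sup>2" for x
      by (simp add: B_def inner_diff_left power2_norm_eq_inner sym)
    have Bpos: "0 \<le> B x \<bullet> x" for x
      using power_mono[OF cS[of x], of 2] c0 by (simp add: Bxx power_mult_distrib)
    have BB: "(norm (B x))\<^sup>2 \<le> K * (B x \<bullet> x)" for x
    proof -
      have "B (B x) \<bullet> B x \<le> norm (B (B x)) * norm (B x)"
        by (rule norm_cauchy_schwarz)
      also have "\<dots> \<le> (norm (B x) * K) * norm (B x)"
        by (intro mult_right_mono K) auto
      finally have 1: "B (B x) \<bullet> B x \<le> K * (norm (B x))\<^sup>2"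
        by (simp add: power2_eq_square mult_ac)
      \<comment> \<open>The step \<open>1/K\<close> minimizes the resulting quadratic bound in the
        step length; positivity of the form at this vector gives the claim.\<close>
      have "0 \<le> B (x - (1/K) *\<^sub>R B x) \<bullet> (x - (1/K) *\<^sub>R B x)"
        by (rule Bpos)
      also have "\<dots> = B x \<bullet> x - 2 / K * (norm (B x))\<^sup>2 + (B (B x) \<bullet> B x) / K / K"
        unfolding B.diff B.scaleR inner_diff_left inner_diff_right inner_scaleR_left
          inner_scaleR_right Bsym[of "B x" x] power2_norm_eq_inner by (simp add: algebra_simps)
      also have "\<dots> \<le> B x \<bullet> x - 2 / K * (norm (B x))\<^sup>2 + (K * (norm (B x))\<^sup>2) / K / K"
        using K(1) 1 by (intro add_left_mono divide_right_mono) auto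
      also have "\<dots> = B x \<bullet> x - (norm (B x))\<^sup>2 / K"
        using K(1) by (simp add: field_simps)
      finally show ?thesis
        using K(1) by (simp add: field_simps)
    qed
    define d where "d = d1 * d2"
    have d: "d > 0" using d1 d2 by (simp add: d_def)
    \<comment> \<open>\<open>B\<close> factors as (S - c)(S + c), so the two lower bounds
      multiply.\<close>
    have Bd: "d * norm x \<le> norm (B x)" for x
    proof -
      have "d * norm x \<le> d1 * norm (S x + c *\<^sub>R x)"
        using d1(1) d2(2)[of x] by (simp add: d_def mult.assoc)
      also have "\<dots> \<le> norm (B x)"
        using d1(2)[of "S x + c *\<^sub>R x"]
        by (simp add: B_def S.add S.scaleR algebra_simps power2_eq_square)
      finally show ?thesis .
    qed
    \<comment> \<open>Combining \<open>Bd\<close> with \<open>BB\<close> bounds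
      \<open>K * ((norm (S x))\<^sup>2 - c\<^sup>2 * (norm x)\<^sup>2)\<close> below by
      \<open>d\<^sup>2 * (norm x)\<^sup>2\<close>. Solving for \<open>norm (S x)\<close> produces
      this constant, which exceeds the infimum \<open>c\<close>.\<close>
    define c2 where "c2 = sqrt (c\<^sup>2 + d\<^sup>2 / K)"
    have c2S: "c2 * norm x \<le> norm (S x)" for x
    proof (rule power2_le_imp_le)
      have "d\<^sup>2 * (norm x)\<^sup>2 \<le> K * ((norm (S x))\<^sup>2 - c\<^sup>2 * (norm x)\<^sup>2)"
        using power_mono[OF Bd[of x], of 2] BB[of x] d by (simp add: power_mult_distrib Bxx)
      then show "(c2 * norm x)\<^sup>2 \<le> (norm (S x))\<^sup>2"
        using K(1) by (simp add: c2_def power_mult_distrib field_simps)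
    qed auto
    have "c2 \<le> c"
      unfolding c_def
    proof (rule cInf_greatest)
      fix r assume "r \<in> R"
      then show "c2 \<le> r"
        using c2S by (auto simp: R_def pos_le_divide_eq)
    qed (use Ru in auto)
    moreover have "c < c2"
      unfolding c2_def using c0 d K(1) by (intro real_less_rsqrt) auto
    ultimately show False by simp
  qed
  with ce c0 show thesis
    using that[of c] that[of "- c"] by auto
qed

section \<open>Bounded operators on the space of square-summable functions\<close>

text \<open>Bridge from operators on the type to operators on functions, which are only seen on
  \<open>ell2\<close>. Commutation with \<open>cscale\<close> is a separate premise because
  \<open>bounded_linear\<close> records real linearity alone.\<close>

lemma bounded_operatorI:
  assumes T: "\<And>u. T (coord u) = coord (G u)" and G: "bounded_linear G"
    and sc: "\<And>c u. G (cscale c u) = cscale c (G u)"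
  shows "bounded_operator T"
proof -
  interpret bounded_linear G by fact
  obtain K where K: "\<And>x. norm (G x) \<le> norm x * K"
    using bounded by blast
  have *: "T u = coord (G (Abs_l2 u))" if "u \<in> ell2" for u
    using T[of "Abs_l2 u"] that by (simp add: Abs_l2_inverse)
  have "T (\<lambda>i. u i + v i) = (\<lambda>i. T u i + T v i)" if "u \<in> ell2" "v \<in> ell2" for u v
  proof -
    have "(\<lambda>i. u i + v i) = coord (Abs_l2 u + Abs_l2 v)"
      using that by (auto simp: Abs_l2_inverse)
    then show ?thesis
      by (auto simp: T add * that)
  qed
  moreover have "T (\<lambda>i. c * u i) = (\<lambda>i. c * T u i)" if "u \<in> ell2" for u c
  proof -
    have "(\<lambda>i. c * u i) = coord (cscale c (Abs_l2 u))"
      using that by (auto simp: Abs_l2_inverse)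
    then show ?thesis
      by (auto simp: T sc * that)
  qed
  moreover have "ell2_norm (T u) \<le> K * ell2_norm u" if "u \<in> ell2" for u
    using K[of "Abs_l2 u"] that by (simp add: norm_eq_ell2_norm * Abs_l2_inverse mult.commute)
  ultimately show ?thesis
    unfolding bounded_operator_def by (auto simp: * coord intro!: exI[of _ K])
qed

lemma bounded_operatorE:
  assumes "bounded_operator T"
  obtains G where "\<And>u. T (coord u) = coord (G u)" "bounded_linear G"
    "\<And>c u. G (cscale c u) = cscale c (G u)"
proof -
  define G where "G u = Abs_l2 (T (coord u))" for u
  have cG: "coord (G u) = T (coord u)" for u
    using assms coord[of u] by (simp add: G_def Abs_l2_inverse bounded_operator_def)
  have add: "T (\<lambda>i. coord u i + coord v i) = (\<lambda>i. T (coord u) i + T (coord v) i)"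
    and sc: "T (\<lambda>i. c * coord u i) = (\<lambda>i. c * T (coord u) i)" for u v c
    using assms coord[of u] coord[of v] by (auto simp: bounded_operator_def)
  obtain C where C: "\<And>u. u \<in> ell2 \<Longrightarrow> ell2_norm (T u) \<le> C * ell2_norm u"
    using assms unfolding bounded_operator_def by metis
  have eqs: "coord (u + v) = (\<lambda>i. coord u i + coord v i)" "coord (cscale c u) = (\<lambda>i. c * coord u i)"
    "coord (r *\<^sub>R u) = (\<lambda>i. of_real r * coord u i)" for u v c r
    by (auto simp: scaleR_conv_of_real)
  have "bounded_linear G"
  proof (rule bounded_linear_intro[where K = C])
    show "norm (G u) \<le> norm u * C" for u
      using C[OF coord[of u]] by (simp add: norm_eq_ell2_norm cG mult.commute)
  qed (auto intro!: l2_eqI simp: cG eqs(1,3) add sc scaleR_conv_of_real)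
  moreover have "G (cscale c u) = cscale c (G u)" for c u
    by (rule l2_eqI) (simp add: cG eqs(2) sc)
  ultimately show thesis
    using that[of G] cG by simp
qed

lemma bounded_below_surj_inverse:
  fixes G :: "'i l2 \<Rightarrow> 'i l2"
  assumes "bounded_linear G" and sc: "\<And>c u. G (cscale c u) = cscale c (G u)"
    and "bounded_below G" "surj G"
  obtains H where "bounded_linear H" "\<And>c u. H (cscale c u) = cscale c (H u)"
    "\<And>u. H (G u) = u" "\<And>u. G (H u) = u"
proof -
  interpret bounded_linear G by fact
  obtain c where c: "c > 0" "\<And>x. c * norm x \<le> norm (G x)"
    using assms(3) by (auto simp: bounded_below_def)
  have inj: "inj G"
  proof (rule injI)
    fix x y assume "G x = G y"
    then show "x = y"
      using c(2)[of "x - y"] c(1) by (simp add: diff mult_le_0_iff)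
  qed
  define H where "H = inv G"
  have HG: "H (G u) = u" and GH: "G (H u) = u" for u
    using inj \<open>surj G\<close> by (simp_all add: H_def surj_f_inv_f)
  show thesis
  proof (rule that[OF _ _ HG GH])
    show "bounded_linear H"
    proof (rule bounded_linear_intro[where K = "1 / c"])
      show "H (x + y) = H x + H y" for x y
        using inj by (rule injD) (simp add: add GH)
      show "H (r *\<^sub>R x) = r *\<^sub>R H x" for x r
        using inj by (rule injD) (simp add: scaleR GH)
      show "norm (H x) \<le> norm x * (1 / c)" for x
        using c(2)[of "H x"] c(1) by (simp add: field_simps GH)
    qed
    show "H (cscale r u) = cscale r (H u)" for r u
      using inj by (rule injD) (simp add: sc GH)
  qed
qed

lemma invertible_operatorI:
  assumes T: "\<And>u. T (coord u) = coord (G u)" and G: "bounded_linear G"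
    "\<And>c u. G (cscale c u) = cscale c (G u)" "bounded_below G" "surj G"
  shows "invertible_operator T"
proof -
  obtain H where H: "bounded_linear H" "\<And>c u. H (cscale c u) = cscale c (H u)"
    and inv [simp]: "\<And>u. H (G u) = u" "\<And>u. G (H u) = u"
    using bounded_below_surj_inverse[OF G] by metis
  define S where "S u = coord (H (Abs_l2 u))" for u
  have S: "S (coord u) = coord (H u)" for u
    by (simp add: S_def coord_inverse)
  have "bounded_operator S"
    by (rule bounded_operatorI[where G = H], rule S, rule H(1), rule H(2))
  moreover have "S (T u) = u \<and> T (S u) = u" if "u \<in> ell2" for u
  proof -
    obtain x where x: "u = coord x"
      using \<open>u \<in> ell2\<close> by (metis Abs_l2_inverse)
    show ?thesis
      by (simp add: x T S)
  qed
  ultimately show ?thesis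
    by (auto simp: invertible_operator_def)
qed

lemma invertible_operator_bounded_below:
  assumes T: "\<And>u. T (coord u) = coord (G u)" and "invertible_operator T"
  shows "bounded_below G"
proof -
  obtain S where S: "bounded_operator S" "\<And>u. u \<in> ell2 \<Longrightarrow> S (T u) = u"
    using assms(2) by (auto simp: invertible_operator_def)
  obtain H where H: "\<And>u. S (coord u) = coord (H u)" "bounded_linear H"
    using bounded_operatorE[OF S(1)] by metis
  obtain K where K: "K > 0" "\<And>x. norm (H x) \<le> norm x * K"
    using bounded_linear.pos_bounded[OF H(2)] by blast
  have "H (G u) = u" for u
    using S(2)[OF coord[of u]] by (simp add: T H(1) coord_inject)
  then have "1 / K * norm u \<le> norm (G u)" for u
    using K(2)[of "G u"] K(1) by (simp add: field_simps)
  then show ?thesis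
    unfolding bounded_below_def using K(1) by (intro exI[of _ "1 / K"]) auto
qed

section \<open>Jacobi operators with bounded coefficients\<close>

text \<open>Summing over displacements rather than neighbours makes the index set independent of the
  site, so a Jacobi matrix becomes a finite sum of translations followed by multiplications.\<close>

definition unit_steps :: "(int ^ 'n) set" where
  "unit_steps = {d. adjacent d 0}"

lemma finite_unit_steps: "finite unit_steps"
  unfolding unit_steps_def by (rule finite_adjacent)

lemma adjacent_iff_unit_steps: "adjacent m n \<longleftrightarrow> m - n \<in> unit_steps"
  by (simp add: unit_steps_def adjacent_def)

lemma uminus_unit_steps [simp]: "- d \<in> unit_steps \<longleftrightarrow> d \<in> unit_steps"
proof -
  have "lattice_vec (- d) = - lattice_vec d"
    by (simp add: lattice_vec_def vec_eq_iff)
  then show ?thesis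
    by (simp add: unit_steps_def adjacent_def)
qed

lemma adjacent_unit_step [simp]: "d \<in> unit_steps \<Longrightarrow> adjacent (n + d) n"
  by (simp add: adjacent_iff_unit_steps)

definition bounded_bonds :: "((int ^ 'n) set \<Rightarrow> real) \<Rightarrow> bool" where
  "bounded_bonds a \<longleftrightarrow> (\<exists>C. \<forall>m n. adjacent m n \<longrightarrow> \<bar>a {n, m}\<bar> \<le> C)"

text \<open>The potential is complex so that J - z is again of this form, with potential b -
  z.\<close>

definition jacobi_op :: "((int ^ 'n) set \<Rightarrow> real) \<Rightarrow> (int ^ 'n \<Rightarrow> complex)
    \<Rightarrow> (int ^ 'n) l2 \<Rightarrow> (int ^ 'n) l2" where
  "jacobi_op a w u =
     (\<Sum>d\<in>unit_steps. mult (\<lambda>n. of_real (a {n, n + d})) (transl d u)) + mult w u"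

lemma bounded_range_bond:
  assumes "bounded_bonds a" "d \<in> unit_steps"
  shows "bounded (range (\<lambda>n. complex_of_real (a {n, n + d})))"
proof -
  obtain C where "\<And>m n. adjacent m n \<Longrightarrow> \<bar>a {n, m}\<bar> \<le> C"
    using assms(1) by (auto simp: bounded_bonds_def)
  then show ?thesis
    using assms(2) by (auto simp: bounded_iff intro!: exI[of _ C])
qed

lemma coord_jacobi_op:
  assumes "bounded_bonds a" "bounded (range w)"
  shows "coord (jacobi_op a w u) n =
    (\<Sum>d\<in>unit_steps. of_real (a {n, n + d}) * coord u (n + d)) + w n * coord u n"
  using assms by (simp add: jacobi_op_def coord_sum coord_mult bounded_range_bond)

lemma bounded_linear_jacobi_op:
  assumes "bounded_bonds a" "bounded (range w)"
  shows "bounded_linear (jacobi_op a w)"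
  unfolding jacobi_op_def[abs_def]
  by (intro bounded_linear_add bounded_linear_sum bounded_linear_mult assms
      bounded_linear_compose[OF bounded_linear_mult bounded_linear_transl] bounded_range_bond)

lemma jacobi_op_cscale:
  assumes "bounded_bonds a" "bounded (range w)"
  shows "jacobi_op a w (cscale c u) = cscale c (jacobi_op a w u)"
  by (rule l2_eqI) (simp add: coord_jacobi_op[OF assms] sum_distrib_left algebra_simps)

text \<open>The adjoint of the term for step d is the term for -d, because \<open>{n, n + d}\<close>
  is unordered and its coefficient is real. Reindexing by sign change restores the sum, and only the
  potential gets conjugated.\<close>

lemma inner_jacobi_op:
  assumes "bounded_bonds a" "bounded (range w)"
  shows "jacobi_op a w u \<bullet> v = u \<bullet> jacobi_op a (\<lambda>n. cnj (w n)) v"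
proof -
  have "(mult (\<lambda>n. of_real (a {n, n + d})) (transl d u)) \<bullet> v
      = u \<bullet> mult (\<lambda>n. of_real (a {n, n + - d})) (transl (- d) v)" if d: "d \<in> unit_steps" for d
  proof -
    have "transl (- d) (mult (\<lambda>n. of_real (a {n, n + d})) v)
        = mult (\<lambda>n. of_real (a {n, n + - d})) (transl (- d) v)"
      using bounded_range_bond[OF assms(1) d] bounded_range_bond[OF assms(1), of "- d"] d
      by (intro l2_eqI) (simp add: coord_mult insert_commute)
    then show ?thesis
      by (simp add: inner_mult[OF bounded_range_bond[OF assms(1) d]] inner_transl)
  qed
  then have "(\<Sum>d\<in>unit_steps. mult (\<lambda>n. of_real (a {n, n + d})) (transl d u) \<bullet> v)
      = (\<Sum>d\<in>unit_steps. u \<bullet> mult (\<lambda>n. of_real (a {n, n + - d})) (transl (- d) v))"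
    by (intro sum.cong) auto
  also have "\<dots> = (\<Sum>d\<in>unit_steps. u \<bullet> mult (\<lambda>n. of_real (a {n, n + d})) (transl d v))"
    by (rule sum.reindex_bij_witness[of _ uminus uminus]) auto
  finally show ?thesis
    by (simp add: jacobi_op_def inner_add_left inner_add_right inner_sum_left inner_sum_right
        inner_mult[OF assms(2)])
qed

lemma jacobi_op_add_potential:
  assumes "bounded_bonds a" "bounded (range w)" "bounded (range w')"
  shows "jacobi_op a (\<lambda>n. w n + w' n) u = jacobi_op a w u + mult w' u"
proof -
  have "bounded (range (\<lambda>n. w n + w' n))"
    using bounded_plus_comp[OF assms(2,3)] .
  then show ?thesis
    using assms by (intro l2_eqI) (simp add: coord_jacobi_op coord_mult algebra_simps)
qed

text \<open>Conjugation by a translation moves the coefficients, with \<open>(+) p\<close> applied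
  to a bond giving the translated bond. This is how the shifted coefficients in the definition of a
  limit point enter.\<close>

lemma transl_jacobi_op:
  assumes "bounded_bonds a" "bounded (range w)"
  shows "transl p (jacobi_op a w u)
    = jacobi_op (\<lambda>s. a ((+) p ` s)) (\<lambda>n. w (p + n)) (transl p u)"
    and "bounded_bonds (\<lambda>s. a ((+) p ` s))" and "bounded (range (\<lambda>n. w (p + n)))"
proof -
  show 1: "bounded_bonds (\<lambda>s. a ((+) p ` s))"
    using assms(1) by (auto simp: bounded_bonds_def adjacent_iff_unit_steps)
       (metis add_diff_cancel_left)
  show 2: "bounded (range (\<lambda>n. w (p + n)))"
    using assms(2) by (rule bounded_subset) auto
  show "transl p (jacobi_op a w u) = jacobi_op (\<lambda>s. a ((+) p ` s)) (\<lambda>n. w (p + n)) (transl p u)"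
    by (rule l2_eqI, simp only: coord_transl coord_jacobi_op[OF assms] coord_jacobi_op[OF 1 2])
       (simp add: add.assoc add.commute add.left_commute)
qed

lemma bounded_range_shift:
  assumes "bounded (range (b :: 'i \<Rightarrow> real))"
  shows "bounded (range (\<lambda>n. complex_of_real (b n) - z))"
proof -
  have "bounded (range (\<lambda>n. complex_of_real (b n)))"
    using assms by (auto simp: bounded_iff)
  then show ?thesis
    using bounded_minus_comp[of "\<lambda>n. complex_of_real (b n)" UNIV "\<lambda>_. z"] by simp
qed

lemma jacobi_coord:
  assumes "bounded_bonds a" "bounded (range b)"
  shows "shift_by (jacobi a b) z (coord u) = coord (jacobi_op a (\<lambda>n. of_real (b n) - z) u)"
proof (rule ext)
  fix n
  have "(\<Sum>m | adjacent m n. complex_of_real (a {n, m}) * coord u m)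
      = (\<Sum>d\<in>unit_steps. of_real (a {n, n + d}) * coord u (n + d))"
    by (rule sum.reindex_bij_witness[of _ "\<lambda>d. n + d" "\<lambda>m. m - n"])
       (auto simp: adjacent_iff_unit_steps)
  then show "shift_by (jacobi a b) z (coord u) n = coord (jacobi_op a (\<lambda>n. of_real (b n) - z) u) n"
    by (simp add: shift_by_def jacobi_def coord_jacobi_op[OF assms(1) bounded_range_shift[OF assms(2)]]
        left_diff_distrib)
qed

lemma cscale_minus: "cscale (- c) u = - cscale c u"
  by (rule l2_eqI) simp

text \<open>The quadratic form of a symmetric operator is real, and the inner product here is the
  real part of the Hermitian one.\<close>

lemma inner_jacobi_op_imaginary:
  assumes "bounded_bonds a" "bounded (range (\<lambda>n. complex_of_real (v n)))"
  shows "jacobi_op a (\<lambda>n. of_real (v n)) u \<bullet> cscale \<i> u = 0"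
proof -
  have "jacobi_op a (\<lambda>n. of_real (v n)) u \<bullet> cscale \<i> u
      = u \<bullet> cscale \<i> (jacobi_op a (\<lambda>n. of_real (v n)) u)"
    using inner_jacobi_op[OF assms] by (simp add: jacobi_op_cscale[OF assms])
  also have "\<dots> = - (cscale \<i> u \<bullet> jacobi_op a (\<lambda>n. of_real (v n)) u)"
    by (simp add: inner_mult cscale_minus)
  finally show ?thesis
    by (simp add: inner_commute)
qed

text \<open>Pythagoras: the contribution of the imaginary part of z is a real multiple of \<i> u,
  which is orthogonal to the symmetric part applied to u.\<close>

lemma norm_jacobi_op_shift:
  assumes "bounded_bonds a" "bounded (range b)"
  shows "(norm (jacobi_op a (\<lambda>n. of_real (b n) - z) u))\<^sup>2
    = (norm (jacobi_op a (\<lambda>n. of_real (b n - Re z)) u))\<^sup>2 + (Im z)\<^sup>2 * (norm u)\<^sup>2"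
proof -
  have b: "bounded (range (\<lambda>n. complex_of_real (b n - Re z)))"
    using bounded_minus_comp[OF assms(2), of "\<lambda>_. Re z"]
    by (auto simp: bounded_iff simp del: of_real_diff)
  have "(\<lambda>n. of_real (b n) - z) = (\<lambda>n. complex_of_real (b n - Re z) + (- of_real (Im z) * \<i>))"
    by (rule ext) (simp add: complex_eq_iff)
  then have eq: "jacobi_op a (\<lambda>n. of_real (b n) - z) u
      = jacobi_op a (\<lambda>n. of_real (b n - Re z)) u + cscale (- of_real (Im z) * \<i>) u"
    using jacobi_op_add_potential[OF assms(1) b, of "\<lambda>_. - of_real (Im z) * \<i>"] by simp
  have "cscale (- of_real (Im z) * \<i>) u = (- Im z) *\<^sub>R cscale \<i> u"
    by (rule l2_eqI) (simp add: scaleR_conv_of_real)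
  then have orth: "jacobi_op a (\<lambda>n. of_real (b n - Re z)) u \<bullet> cscale (- of_real (Im z) * \<i>) u = 0"
    using inner_jacobi_op_imaginary[OF assms(1) b] by simp
  show ?thesis
    unfolding eq power2_norm_eq_inner inner_add_left inner_add_right
    using orth norm_cscale[of "- of_real (Im z) * \<i>" u]
    by (simp add: inner_commute[of "cscale _ u"] flip: power2_norm_eq_inner)
       (simp add: norm_mult power_mult_distrib)
qed

text \<open>Conjugating z does not change the norms of the images, so a lower bound passes to the
  adjoint, and the two bounds together give surjectivity.\<close>

lemma spectrum_jacobi:
  assumes "bounded_bonds a" "bounded (range b)"
  shows "z \<in> spectrum (jacobi a b) \<longleftrightarrow> \<not> bounded_below (jacobi_op a (\<lambda>n. of_real (b n) - z))"
proof -
  have b: "bounded (range (\<lambda>n. complex_of_real (b n) - z))" for z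
    by (rule bounded_range_shift[OF assms(2)])
  have "norm (jacobi_op a (\<lambda>n. of_real (b n) - cnj z) u) = norm (jacobi_op a (\<lambda>n. of_real (b n) - z) u)" for u
  proof -
    have "(norm (jacobi_op a (\<lambda>n. of_real (b n) - cnj z) u))\<^sup>2
        = (norm (jacobi_op a (\<lambda>n. of_real (b n) - z) u))\<^sup>2"
      unfolding norm_jacobi_op_shift[OF assms] by simp
    then show ?thesis
      by simp
  qed
  then have "bounded_below (jacobi_op a (\<lambda>n. of_real (b n) - cnj z))"
    if "bounded_below (jacobi_op a (\<lambda>n. of_real (b n) - z))"
    using that by (simp add: bounded_below_def)
  then have "surj (jacobi_op a (\<lambda>n. of_real (b n) - z))"
    if "bounded_below (jacobi_op a (\<lambda>n. of_real (b n) - z))"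
    using that bounded_linear_jacobi_op[OF assms(1) b] inner_jacobi_op[OF assms(1) b, of z]
    by (intro bounded_below_imp_surj[where A' = "jacobi_op a (\<lambda>n. of_real (b n) - cnj z)"]) auto
  then have "invertible_operator (shift_by (jacobi a b) z)"
    if "bounded_below (jacobi_op a (\<lambda>n. of_real (b n) - z))"
    using that by (intro invertible_operatorI[where G = "jacobi_op a (\<lambda>n. of_real (b n) - z)"]
        jacobi_coord[OF assms] bounded_linear_jacobi_op[OF assms(1) b]
        jacobi_op_cscale[OF assms(1) b]) auto
  moreover have "bounded_below (jacobi_op a (\<lambda>n. of_real (b n) - z))"
    if "invertible_operator (shift_by (jacobi a b) z)"
    using jacobi_coord[OF assms] that by (rule invertible_operator_bounded_below)
  ultimately show ?thesis
    by (auto simp: spectrum_def)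
qed


section \<open>Singular sequences at infinity and the Fredholm property\<close>

text \<open>Finite supports allow later vectors to be placed disjointly from earlier ones. The set
  \<open>V\<close> is a parameter because the vectors will have to be found inside the range of
  \<open>G\<close>.\<close>

definition singular_at_infinity :: "'i l2 set \<Rightarrow> ('i l2 \<Rightarrow> 'i l2) \<Rightarrow> bool" where
  "singular_at_infinity V G \<longleftrightarrow>
     (\<forall>e>0. \<forall>F. finite F \<longrightarrow>
        (\<exists>u\<in>V. u \<noteq> 0 \<and> (\<forall>n\<in>F. coord u n = 0) \<and> finite {n. coord u n \<noteq> 0}
          \<and> norm (G u) < e * norm u))"

definition csubspace :: "'i l2 set \<Rightarrow> bool" where
  "csubspace V \<longleftrightarrow> (\<forall>u\<in>V. \<forall>v\<in>V. u + v \<in> V) \<and> (\<forall>u\<in>V. \<forall>c. cscale c u \<in> V)"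

lemma scaleR_eq_cscale: "r *\<^sub>R u = cscale (of_real r) u"
  by (rule l2_eqI) (simp add: scaleR_conv_of_real)

lemma csubspace_diff:
  assumes "csubspace V" "u \<in> V" "v \<in> V"
  shows "u - v \<in> V"
proof -
  have "u - v = u + cscale (- 1) v"
    by (rule l2_eqI) simp
  with assms show ?thesis
    by (metis csubspace_def)
qed

lemma inner_disjoint_support:
  assumes "\<And>n. coord u n = 0 \<or> coord v n = 0"
  shows "u \<bullet> v = 0"
proof -
  have "coord u n \<bullet> coord v n = 0" for n
    using assms[of n] by auto
  then show ?thesis
    by (simp add: inner_l2_eq)
qed

text \<open>
  A suitable combination of two singular vectors with disjoint supports eliminates the component
  along one additional dimension of the complement.
\<close>

lemma singular_at_infinity_finite_codim:
  assumes G: "bounded_linear G" "\<And>c u. G (cscale c u) = cscale c (G u)"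
    and sing: "singular_at_infinity UNIV G"
    and "finite B" "csubspace V" "\<And>u. \<exists>v\<in>V. \<exists>c. u = v + (\<Sum>w\<in>B. cscale (c w) w)"
  shows "singular_at_infinity V G"
  using assms(4-)
proof (induction B arbitrary: V rule: finite_induct)
  case empty
  then have "V = UNIV" by auto
  then show ?case using sing by simp
next
  case (insert w B)
  interpret G: bounded_linear G by fact
  have Vadd: "u + v \<in> V" and Vsc: "cscale c u \<in> V" if "u \<in> V" "v \<in> V" for u v c
    using insert.prems(1) that by (auto simp: csubspace_def)
  \<comment> \<open>Adjoining the line through \<open>w\<close> leaves a complement spanned by
    \<open>B\<close> alone, so the induction hypothesis supplies singular vectors in
    \<open>V'\<close>.\<close>
  define V' where "V' = {v + cscale c w | v c. v \<in> V}"
  have sing': "singular_at_infinity V' G"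
  proof (rule insert.IH)
    have "(v + cscale c w) + (v' + cscale c' w) = (v + v') + cscale (c + c') w"
      and "cscale d (v + cscale c w) = cscale d v + cscale (d * c) w" for v v' c c' d
      by (rule l2_eqI; simp add: algebra_simps)+
    then show "csubspace V'"
      unfolding csubspace_def V'_def using Vadd Vsc by safe metis+
    fix u
    obtain v c where vc: "v \<in> V" "u = v + (\<Sum>x\<in>insert w B. cscale (c x) x)"
      using insert.prems(2)[of u] by auto
    then have "u = (v + cscale (c w) w) + (\<Sum>x\<in>B. cscale (c x) x)"
      using insert.hyps by (simp add: add.assoc)
    then show "\<exists>v\<in>V'. \<exists>c. u = v + (\<Sum>x\<in>B. cscale (c x) x)"
      using vc(1) by (auto simp: V'_def)
  qed
  show ?case
    unfolding singular_at_infinity_def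
  proof (intro allI impI)
    fix e :: real and F :: "'a set"
    assume e: "e > 0" and F: "finite F"
    obtain y1 where y1: "y1 \<in> V'" "y1 \<noteq> 0" "\<And>n. n \<in> F \<Longrightarrow> coord y1 n = 0"
      "finite {n. coord y1 n \<noteq> 0}" "norm (G y1) < e / 2 * norm y1"
      using sing' e F unfolding singular_at_infinity_def by (metis half_gt_zero)
    \<comment> \<open>Vanishing on \<open>F2\<close> makes the second vector disjoint from the
      first.\<close>
    define F2 where "F2 = F \<union> {n. coord y1 n \<noteq> 0}"
    have "finite F2"
      using F y1(4) by (simp add: F2_def)
    then obtain y2 where y2: "y2 \<in> V'" "y2 \<noteq> 0" "\<And>n. n \<in> F2 \<Longrightarrow> coord y2 n = 0"
      "finite {n. coord y2 n \<noteq> 0}" "norm (G y2) < e / 2 * norm y2"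
      using sing' e unfolding singular_at_infinity_def by (metis half_gt_zero)
    obtain v1 c1 where v1: "v1 \<in> V" "y1 = v1 + cscale c1 w"
      using y1(1) by (auto simp: V'_def)
    obtain v2 c2 where v2: "v2 \<in> V" "y2 = v2 + cscale c2 w"
      using y2(1) by (auto simp: V'_def)
    show "\<exists>u\<in>V. u \<noteq> 0 \<and> (\<forall>n\<in>F. coord u n = 0) \<and> finite {n. coord u n \<noteq> 0} \<and> norm (G u) < e * norm u"
    proof (cases "c1 = 0")
      case True
      then have "y1 = v1"
        using v1(2) by (intro l2_eqI) simp
      moreover have "norm (G y1) < e * norm y1"
      proof -
        have "e / 2 * norm y1 \<le> e * norm y1"
          using e by (intro mult_right_mono) auto
        with y1(5) show ?thesis by linarith
      qed
      ultimately show ?thesis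
        using v1(1) y1 by auto
    next
      case False
      \<comment> \<open>These coefficients cancel the \<open>w\<close> components. Disjoint supports
        prevent cancellation of norms: \<open>y\<close> is at least as long as each summand, so the
        two errors e/2 add up to e.\<close>
      define x1 x2 where "x1 = cscale c2 y1" and "x2 = cscale (- c1) y2"
      define y where "y = x1 + x2"
      have "y = cscale c2 v1 + cscale (- c1) v2"
        unfolding y_def x1_def x2_def v1(2) v2(2) by (rule l2_eqI) (simp add: algebra_simps)
      then have "y \<in> V"
        using v1(1) v2(1) Vadd Vsc by simp
      have "x1 \<bullet> x2 = 0"
        by (rule inner_disjoint_support) (use y2(3) in \<open>auto simp: x1_def x2_def F2_def\<close>)
      then have "(norm y)\<^sup>2 = (norm x1)\<^sup>2 + (norm x2)\<^sup>2"
        by (simp add: y_def power2_norm_eq_inner inner_add_left inner_add_right inner_commute)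
      then have le: "norm x1 \<le> norm y" "norm x2 \<le> norm y"
        by (auto intro: power2_le_imp_le)
      have "norm x2 > 0"
        using False y2(2) by (simp add: x2_def norm_cscale)
      have "norm (G x1) \<le> e / 2 * norm x1"
        using mult_left_mono[OF less_imp_le[OF y1(5)], of "cmod c2"]
        by (simp add: x1_def G(2) norm_cscale mult_ac)
      moreover have "norm (G x2) < e / 2 * norm x2"
        using mult_strict_left_mono[OF y2(5), of "cmod c1"] False
        by (simp add: x2_def G(2) norm_cscale mult_ac)
      moreover have "norm (G y) \<le> norm (G x1) + norm (G x2)"
        by (simp add: y_def G.add norm_triangle_ineq)
      moreover have "e / 2 * norm x1 \<le> e / 2 * norm y" "e / 2 * norm x2 \<le> e / 2 * norm y"
        using le e by (auto intro!: mult_left_mono)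
      ultimately have "norm (G y) < e * norm y"
        by simp
      moreover have "y \<noteq> 0"
        using \<open>norm x2 > 0\<close> le by auto
      moreover have "finite {n. coord y n \<noteq> 0}"
        by (rule finite_subset[of _ "{n. coord y1 n \<noteq> 0} \<union> {n. coord y2 n \<noteq> 0}"])
           (use y1(4) y2(4) in \<open>auto simp: y_def x1_def x2_def\<close>)
      moreover have "\<forall>n\<in>F. coord y n = 0"
        using y1(3) y2(3) by (simp add: y_def x1_def x2_def F2_def)
      ultimately show ?thesis
        using \<open>y \<in> V\<close> by blast
    qed
  qed
qed

text \<open>Gliding hump: each vector is chosen together with a finite set containing all supports
  so far, on which the next one must vanish. The rate \<open>(1/4) ^ m\<close> is meant to outweigh
  coefficients growing like \<open>2 ^ m\<close>.\<close>

lemma singular_at_infinity_orthonormal: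
  assumes G: "bounded_linear G" and V: "csubspace V" "singular_at_infinity V G"
  obtains y :: "nat \<Rightarrow> 'i l2" where "\<And>m. y m \<in> V" "\<And>m. norm (y m) = 1"
    "\<And>m. norm (G (y m)) \<le> (1/4) ^ m" "\<And>m k. m \<noteq> k \<Longrightarrow> y m \<bullet> y k = 0"
proof -
  interpret G: bounded_linear G by fact
  define P where "P n = (\<lambda>(y, F). finite F \<and> (\<forall>i. i \<notin> F \<longrightarrow> coord y i = 0) \<and> y \<in> V
      \<and> norm y = 1 \<and> norm (G y) \<le> (1/4) ^ n)" for n
  define Q :: "nat \<Rightarrow> 'i l2 \<times> 'i set \<Rightarrow> 'i l2 \<times> 'i set \<Rightarrow> bool" where
    "Q n = (\<lambda>(y, F) (y', F'). F \<subseteq> F' \<and> (\<forall>i\<in>F. coord y' i = 0))" for n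
  have ex: "\<exists>x'. P n x' \<and> snd x \<subseteq> snd x' \<and> (\<forall>i\<in>snd x. coord (fst x') i = 0)"
    if fin: "finite (snd x)" for x :: "'i l2 \<times> 'i set" and n
  proof -
    obtain u where u: "u \<in> V" "u \<noteq> 0" "\<forall>i\<in>snd x. coord u i = 0" "finite {i. coord u i \<noteq> 0}"
      "norm (G u) < (1/4) ^ n * norm u"
      using V(2)[unfolded singular_at_infinity_def, rule_format, of "(1/4) ^ n", OF _ fin] by auto
    define y where "y = (1 / norm u) *\<^sub>R u"
    have "y \<in> V"
      using V(1) u(1) by (simp add: y_def scaleR_eq_cscale csubspace_def)
    moreover have "norm y = 1"
      using u(2) by (simp add: y_def)
    moreover have "norm (G y) \<le> (1/4) ^ n"
      using u(2,5) by (simp add: y_def G.scaleR field_simps)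
    ultimately have "P n (y, snd x \<union> {i. coord u i \<noteq> 0})"
      using u(4) that by (auto simp: P_def y_def)
    then show ?thesis
      using u(3) by (intro exI[of _ "(y, snd x \<union> {i. coord u i \<noteq> 0})"]) (auto simp: y_def)
  qed
  have "\<exists>f. \<forall>n. P n (f n) \<and> Q n (f n) (f (Suc n))"
  proof (rule dependent_nat_choice)
    show "\<exists>x. P 0 x"
      using ex[of "(0, {})" 0] by auto
    show "\<exists>y. P (Suc n) y \<and> Q n x y" if "P n x" for x n
    proof -
      have "finite (snd x)"
        using that by (simp add: P_def split_beta)
      then obtain x' where "P (Suc n) x'" "snd x \<subseteq> snd x'" "\<forall>i\<in>snd x. coord (fst x') i = 0"
        using ex[of x "Suc n"] by metis
      then show ?thesis
        by (intro exI[of _ x']) (simp add: Q_def split_beta)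
    qed
  qed
  then obtain f where f: "\<And>n. P n (f n)" "\<And>n. Q n (f n) (f (Suc n))"
    by auto
  have mono: "snd (f m) \<subseteq> snd (f k)" if "m \<le> k" for m k
    using that by (rule lift_Suc_mono_le[rotated]) (use f(2) in \<open>auto simp: Q_def split_beta\<close>)
  have orth: "fst (f m) \<bullet> fst (f k) = 0" if mk: "m < k" for m k
  proof (rule inner_disjoint_support)
    fix i
    obtain k' where k: "k = Suc k'"
      using mk by (cases k) auto
    show "coord (fst (f m)) i = 0 \<or> coord (fst (f k)) i = 0"
    proof (cases "i \<in> snd (f m)")
      case True
      then have "i \<in> snd (f k')"
        using mono[of m k'] mk k by auto
      then show ?thesis
        using f(2)[of k'] by (simp add: Q_def split_beta k)
    next
      case False
      then show ?thesis
        using f(1)[of m] by (auto simp: P_def split_beta)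
    qed
  qed
  show thesis
  proof (rule that[of "\<lambda>m. fst (f m)"])
    show "fst (f m) \<bullet> fst (f k) = 0" if "m \<noteq> k" for m k
      using orth[of m k] orth[of k m] that by (cases m k rule: linorder_cases) (auto simp: inner_commute)
  qed (use f(1) in \<open>auto simp: P_def split_beta\<close>)
qed

text \<open>
  If \<open>y\<^sub>m\<close> is an orthonormal sequence in the closed range of \<open>G\<close> with \<open>\<parallel>G y\<^sub>m\<parallel> \<le> 4\<^sup>-\<^sup>m\<close>, then
  \<open>\<Sum>\<^sub>k 2\<^sup>k G y\<^sub>k = G v\<close> for some \<open>v\<close>, and symmetry of \<open>G\<close> forces \<open>\<langle>v, y\<^sub>m\<rangle> = 2\<^sup>m\<close> for all \<open>m\<close>.
\<close>

lemma closed_range_no_singular_orthonormal: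
  fixes G :: "'i l2 \<Rightarrow> 'i l2"
  assumes G: "bounded_linear G" and sym: "\<And>x y. G x \<bullet> y = x \<bullet> G y" and "closed (range G)"
    and y: "\<And>m::nat. y m \<in> range G" "\<And>m. norm (y m) = 1"
    "\<And>m. norm (G (y m)) \<le> (1/4) ^ m" "\<And>m k. m \<noteq> k \<Longrightarrow> y m \<bullet> y k = 0"
  shows False
proof -
  interpret G: bounded_linear G by fact
  \<comment> \<open>The vectors \<open>s N\<close> themselves diverge, but their images converge,
    since the k-th term has norm at most \<open>2 ^ k * (1/4) ^ k\<close>.\<close>
  define s where "s N = (\<Sum>k<N. 2 ^ k *\<^sub>R y k)" for N
  have "summable (\<lambda>k. 2 ^ k *\<^sub>R G (y k))"
  proof (rule summable_comparison_test')
    show "summable (\<lambda>k. (1/2::real) ^ k)"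
      by (rule summable_geometric) simp
    show "norm (2 ^ k *\<^sub>R G (y k)) \<le> (1/2) ^ k" for k
    proof -
      have "2 ^ k * norm (G (y k)) \<le> 2 ^ k * (1/4) ^ k"
        using y(3) by (intro mult_left_mono) auto
      also have "\<dots> = (1/2) ^ k"
        by (simp flip: power_mult_distrib)
      finally show ?thesis by simp
    qed
  qed
  then obtain w where "(\<lambda>k. 2 ^ k *\<^sub>R G (y k)) sums w"
    by (auto simp: summable_def)
  moreover have "G (s N) = (\<Sum>k<N. 2 ^ k *\<^sub>R G (y k))" for N
    by (simp add: s_def G.sum G.scaleR)
  ultimately have lim: "(\<lambda>N. G (s N)) \<longlonglongrightarrow> w"
    by (simp add: sums_def)
  then have "w \<in> range G"
    using closed_sequentially[OF assms(3), of "\<lambda>N. G (s N)"] by auto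
  then obtain v where v: "w = G v" by auto
  \<comment> \<open>Here it matters that \<open>y m\<close> is in the range: writing it as
    \<open>G x\<close> turns the pairing of \<open>v\<close> with \<open>y m\<close> into one of
    \<open>G v\<close>, the known limit, with \<open>x\<close>.\<close>
  have vy: "v \<bullet> y m = 2 ^ m" for m
  proof -
    obtain x where x: "y m = G x"
      using y(1)[of m] by auto
    have "(\<lambda>N. G (s N) \<bullet> x) \<longlonglongrightarrow> w \<bullet> x"
      by (intro tendsto_intros lim)
    moreover have "G (s N) \<bullet> x = 2 ^ m" if "N > m" for N
    proof -
      have "G (s N) \<bullet> x = (\<Sum>k<N. 2 ^ k * (y k \<bullet> y m))"
        by (simp add: sym s_def inner_sum_left flip: x)
      also have "\<dots> = (\<Sum>k\<in>{m}. 2 ^ k * (y k \<bullet> y m))"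
        using that by (intro sum.mono_neutral_right) (auto simp: y(4))
      also have "\<dots> = 2 ^ m"
        using y(2)[of m] by (simp flip: power2_norm_eq_inner)
      finally show ?thesis .
    qed
    then have "\<forall>\<^sub>F N in sequentially. G (s N) \<bullet> x = 2 ^ m"
      by (rule eventually_mono[OF eventually_gt_at_top[of m]])
    then have "(\<lambda>N. G (s N) \<bullet> x) \<longlonglongrightarrow> 2 ^ m"
      by (rule tendsto_eventually)
    ultimately have "w \<bullet> x = 2 ^ m"
      by (rule LIMSEQ_unique)
    then show ?thesis
      by (simp add: v sym x)
  qed
  obtain m where "norm v < 2 ^ m"
    using real_arch_pow[of 2 "norm v"] by auto
  moreover have "2 ^ m \<le> norm v"
    using Cauchy_Schwarz_ineq2[of v "y m"] by (simp add: vy y(2))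
  ultimately show False by simp
qed

lemma range_coord: "range coord = ell2"
  using type_definition.Rep_range[OF type_definition_l2] .

text \<open>Finite codimension of the range moves the singular vectors into the range; there,
  closedness of the range and symmetry exclude an orthonormal sequence of them.\<close>

lemma singular_at_infinity_imp_not_fredholm:
  assumes T: "\<And>u. T (coord u) = coord (G u)"
    and G: "bounded_linear G" "\<And>c u. G (cscale c u) = cscale c (G u)"
    and sym: "\<And>x y. G x \<bullet> y = x \<bullet> G y" and sing: "singular_at_infinity UNIV G"
  shows "\<not> fredholm T"
proof
  assume fred: "fredholm T"
  interpret G: bounded_linear G by fact
  have TG: "T ` ell2 = coord ` range G"
    by (simp add: range_coord[symmetric] image_image T)
  have sub: "csubspace (range G)"
    unfolding csubspace_def by (auto simp: G(2)[symmetric] G.add[symmetric])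
  have clo: "closed (range G)"
    unfolding closed_sequential_limits
  proof (intro allI impI, elim conjE)
    fix X w assume X: "\<forall>n. X n \<in> range G" and lim: "X \<longlonglongrightarrow> w"
    have "(\<lambda>k. norm (X k - w)) \<longlonglongrightarrow> 0"
      using lim by (rule LIM_zero[THEN tendsto_norm_zero])
    then have "(\<lambda>k. ell2_norm (\<lambda>i. coord (X k) i - coord w i)) \<longlonglongrightarrow> 0"
      by (simp add: norm_eq_ell2_norm minus_l2.rep_eq)
    moreover have "coord (X k) \<in> T ` ell2" for k
      using X by (simp add: TG)
    ultimately have "coord w \<in> T ` ell2"
      using fred coord[of w] unfolding fredholm_def ell2_closed_def
      by (elim conjE) (drule spec[of _ "\<lambda>k. coord (X k)"], auto)
    then show "w \<in> range G"
      by (auto simp: TG coord_inject)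
  qed
  obtain B where B: "B \<subseteq> ell2" "finite B"
    "\<And>u. u \<in> ell2 \<Longrightarrow> \<exists>v\<in>T ` ell2. \<exists>c. u = (\<lambda>i. v i + (\<Sum>w\<in>B. c w * w i))"
    using fred by (auto simp: fredholm_def finite_codimensional_def)
  obtain C where C: "finite C" "B = coord ` C"
    using finite_subset_image[OF B(2), of coord UNIV] B(1) by (auto simp: range_coord)
  have "\<exists>v\<in>range G. \<exists>c. u = v + (\<Sum>w\<in>C. cscale (c w) w)" for u
  proof -
    obtain v c where vc: "v \<in> T ` ell2" "coord u = (\<lambda>i. v i + (\<Sum>w\<in>B. c w * w i))"
      using B(3)[OF coord[of u]] by auto
    obtain v' where v': "v' \<in> range G" "v = coord v'"
      using vc(1) by (auto simp: TG)
    have "(\<Sum>w\<in>B. c w * w i) = (\<Sum>w\<in>C. c (coord w) * coord w i)" for i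
      unfolding C(2) by (subst sum.reindex) (auto simp: inj_on_def coord_inject)
    then have "u = v' + (\<Sum>w\<in>C. cscale (c (coord w)) w)"
      by (intro l2_eqI) (simp add: vc(2) v'(2) coord_sum)
    then show ?thesis
      using v'(1) by (intro bexI[of _ v'] exI[of _ "\<lambda>w. c (coord w)"])
  qed
  then have "singular_at_infinity (range G) G"
    by (intro singular_at_infinity_finite_codim[OF G sing C(1) sub])
  then show False
    using singular_at_infinity_orthonormal[OF G(1) sub]
      closed_range_no_singular_orthonormal[OF G(1) sym clo] by metis
qed

section \<open>Fredholm property from an invertible finite-rank perturbation\<close>

text \<open>Induction on the support: a vector \<open>e\<close> of the space with coordinate 1 at
  \<open>x\<close> is used to clear that coordinate by a continuous map \<open>p\<close>. The space
  is the preimage under \<open>p\<close> of its part vanishing at \<open>x\<close>.\<close>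

lemma closed_finite_support_csubspace:
  assumes "finite F" "csubspace V" "\<And>u n. u \<in> V \<Longrightarrow> n \<notin> F \<Longrightarrow> coord u n = 0"
  shows "closed V"
  using assms
proof (induction F arbitrary: V rule: finite_induct)
  case empty
  then have "V \<subseteq> {0}"
    by (auto intro: l2_eqI)
  then show ?case
    using subset_singletonD by fastforce
next
  case (insert x F)
  show ?case
  proof (cases "\<forall>u\<in>V. coord u x = 0")
    case True
    then show ?thesis
      using insert.prems by (intro insert.IH) (metis insert_iff)+
  next
    case False
    then obtain e' where e': "e' \<in> V" "coord e' x \<noteq> 0" by auto
    define e where "e = cscale (1 / coord e' x) e'"
    have e: "cscale c e \<in> V" "coord e x = 1" for c
      using e' insert.prems(1) by (auto simp: e_def csubspace_def)
    define V' where "V' = {u \<in> V. coord u x = 0}"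
    define p where "p u = u - cscale (coord u x) e" for u
    have "closed V'"
    proof (rule insert.IH)
      show "csubspace V'"
        using insert.prems(1) by (auto simp: V'_def csubspace_def)
      show "coord u n = 0" if "u \<in> V'" "n \<notin> F" for u n
        using that insert.prems(2)[of u n] by (cases "n = x") (auto simp: V'_def)
    qed
    moreover have "bounded_linear p"
    proof (rule bounded_linear_intro[where K = "1 + norm e"])
      show "norm (p u) \<le> norm u * (1 + norm e)" for u
        using norm_triangle_ineq4[of u "cscale (coord u x) e"]
          mult_right_mono[OF cmod_coord_le[of u x], of "norm e"]
        by (simp add: p_def norm_cscale algebra_simps)
    qed (auto intro!: l2_eqI simp: p_def algebra_simps)
    then have "continuous_on UNIV p"
      by (rule linear_continuous_on)
    ultimately have "closed (p -` V')"
      by (simp add: closed_vimage)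
    moreover have "p -` V' = V"
    proof (intro equalityI subsetI)
      fix u assume "u \<in> p -` V'"
      then have "p u + cscale (coord u x) e \<in> V"
        using e(1) insert.prems(1) by (auto simp: csubspace_def V'_def)
      then show "u \<in> V"
        by (simp add: p_def)
    next
      fix u assume "u \<in> V"
      then show "u \<in> p -` V'"
        using e csubspace_diff[OF insert.prems(1)] by (simp add: V'_def p_def)
    qed
    ultimately show ?thesis by simp
  qed
qed

text \<open>The definitions of finite (co)dimension sum over a set of vectors. A family
  \<open>g\<close> may repeat vectors, in which case their coefficients are added.\<close>

lemma finite_span_image:
  fixes c :: "'b \<Rightarrow> complex" and g :: "'b \<Rightarrow> 'i \<Rightarrow> complex"
  assumes "finite F"
  shows "\<exists>c'. (\<lambda>i. \<Sum>x\<in>F. c x * g x i) = (\<lambda>i. \<Sum>w\<in>g ` F. c' w * w i)"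
proof (intro exI ext)
  fix i
  have "(\<Sum>x\<in>F. c x * g x i) = (\<Sum>w\<in>g ` F. \<Sum>x\<in>{x \<in> F. g x = w}. c x * g x i)"
    by (rule sum.image_gen[OF assms])
  also have "\<dots> = (\<Sum>w\<in>g ` F. (\<Sum>x\<in>{x \<in> F. g x = w}. c x) * w i)"
    by (intro sum.cong refl) (auto simp: sum_distrib_right intro!: sum.cong)
  finally show "(\<Sum>x\<in>F. c x * g x i) = (\<Sum>w\<in>g ` F. (\<lambda>w. \<Sum>x\<in>{x \<in> F. g x = w}. c x) w * w i)"
    by simp
qed

definition unit_vec :: "'i \<Rightarrow> 'i l2" where
  "unit_vec x = Abs_l2 (\<lambda>i. if i = x then 1 else 0)"

lemma coord_unit_vec [simp]: "coord (unit_vec x) i = (if i = x then 1 else 0)"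
proof -
  have "(\<lambda>i. if i = x then 1 else 0) \<in> ell2"
    unfolding ell2_def mem_Collect_eq
    by (rule finite_nonzero_values_imp_summable_on) auto
  then show ?thesis
    by (simp add: unit_vec_def Abs_l2_inverse)
qed

lemma restr_eq_sum:
  assumes "finite F"
  shows "restr F u = (\<Sum>x\<in>F. cscale (coord u x) (unit_vec x))"
  using assms by (intro l2_eqI) (simp add: coord_sum if_distrib sum.delta cong: if_cong)

text \<open>
  If \<open>A = G + \<i> P\<^sub>F\<close> is invertible, then \<open>G\<close> differs from an invertible operator by an operator
  of finite rank. With \<open>S = A\<^sup>-\<^sup>1\<close>, a vector \<open>y\<close> belongs to the range of \<open>G\<close> iff \<open>P\<^sub>F S y\<close> belongs to
  the range of \<open>1 - \<i> P\<^sub>F S\<close> on the vectors supported in \<open>F\<close>, so the range of \<open>G\<close> is closed.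
\<close>

lemma fredholmI:
  assumes T: "\<And>u. T (coord u) = coord (G u)"
    and G: "bounded_linear G" "\<And>c u. G (cscale c u) = cscale c (G u)"
    and F: "finite F"
    and A: "bounded_below (\<lambda>u. G u + cscale \<i> (restr F u))"
      "surj (\<lambda>u. G u + cscale \<i> (restr F u))"
  shows "fredholm T"
proof -
  interpret G: bounded_linear G by fact
  define P where "P u = cscale \<i> (restr F u)" for u :: "'a l2"
  define A where "A u = G u + P u" for u
  have P: "bounded_linear P"
    unfolding P_def by (intro bounded_linear_compose[OF bounded_linear_mult bounded_linear_restr]) auto
  have "bounded_linear A"
    unfolding A_def using G(1) P by (rule bounded_linear_add)
  moreover have "A (cscale c u) = cscale c (A u)" for c u
    by (rule l2_eqI) (simp add: A_def P_def G(2) algebra_simps)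
  moreover have "bounded_below A" "surj A"
    using assms(5,6) unfolding A_def[abs_def] P_def by auto
  ultimately obtain S where S: "bounded_linear S" "\<And>c u. S (cscale c u) = cscale c (S u)"
    and SA: "\<And>u. S (A u) = u" and AS: "\<And>u. A (S u) = u"
    using bounded_below_surj_inverse[of A] by metis
  interpret S: bounded_linear S by fact
  have GA: "G u = A u - P u" for u
    by (simp add: A_def)
  have P_sum: "P u = (\<Sum>x\<in>F. cscale (\<i> * coord u x) (unit_vec x))" for u
    unfolding P_def using F by (intro l2_eqI) (simp add: restr_eq_sum coord_sum sum_distrib_left mult.assoc)
  have TG: "T ` ell2 = coord ` range G"
    by (simp add: range_coord[symmetric] image_image T)

  have "bounded_operator T"
    by (rule bounded_operatorI[where G = G], rule T, rule G(1), rule G(2))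
  \<comment> \<open>On the kernel \<open>A x = P x\<close>, so \<open>x = S (P x)\<close> is a
    combination of the images under \<open>S\<close> of the unit vectors over
    \<open>F\<close>.\<close>
  moreover have "finite_dimensional {u \<in> ell2. T u = (\<lambda>i. 0)}"
    unfolding finite_dimensional_def
  proof (rule exI, intro conjI ballI)
    show "(\<lambda>x. coord (S (unit_vec x))) ` F \<subseteq> ell2"
      using coord by auto
    show "finite ((\<lambda>x. coord (S (unit_vec x))) ` F)"
      using F by simp
    fix u assume "u \<in> {u \<in> ell2. T u = (\<lambda>i. 0)}"
    then obtain x where x: "u = coord x" "coord (G x) = (\<lambda>i. 0)"
      by (auto simp: T simp flip: range_coord)
    then have "G x = 0"
      by (intro l2_eqI) simp
    then have "x = S (P x)"
      using SA[of x] by (simp add: GA)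
    also have "\<dots> = (\<Sum>y\<in>F. cscale (\<i> * coord x y) (S (unit_vec y)))"
      by (subst P_sum) (simp add: S.sum S(2))
    finally have x_sum: "x = (\<Sum>y\<in>F. cscale (\<i> * coord x y) (S (unit_vec y)))" .
    have "coord x i = (\<Sum>y\<in>F. (\<i> * coord x y) * coord (S (unit_vec y)) i)" for i
      using arg_cong[OF x_sum, of "\<lambda>v. coord v i"] unfolding coord_sum coord_cscale .
    then have "u = (\<lambda>i. \<Sum>y\<in>F. (\<i> * coord x y) * coord (S (unit_vec y)) i)"
      unfolding x(1) by (rule ext)
    then show "\<exists>c. u = (\<lambda>i. \<Sum>w\<in>(\<lambda>x. coord (S (unit_vec x))) ` F. c w * w i)"
      using finite_span_image[OF F, of "\<lambda>y. \<i> * coord x y" "\<lambda>y. coord (S (unit_vec y))"] by simp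
  qed
  moreover have "finite_codimensional (T ` ell2)"
    unfolding finite_codimensional_def
  proof (rule exI, intro conjI ballI)
    show "(\<lambda>x. coord (unit_vec x)) ` F \<subseteq> ell2"
      using coord by blast
    show "finite ((\<lambda>x. coord (unit_vec x)) ` F)"
      using F by simp
    fix u assume "u \<in> (ell2 :: ('a \<Rightarrow> complex) set)"
    then obtain y where y: "u = coord y"
      by (auto simp flip: range_coord)
    obtain c where c: "(\<lambda>i. \<Sum>x\<in>F. (\<i> * coord (S y) x) * coord (unit_vec x) i)
        = (\<lambda>i. \<Sum>w\<in>(\<lambda>x. coord (unit_vec x)) ` F. c w * w i)"
      using finite_span_image[OF F, of "\<lambda>x. \<i> * coord (S y) x" "\<lambda>x. coord (unit_vec x)"] by blast
    have "y = G (S y) + P (S y)"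
      using AS[of y] by (simp add: A_def)
    then have "u = (\<lambda>i. coord (G (S y)) i + coord (P (S y)) i)"
      using y by (metis coord_simps(2) ext)
    also have "\<dots> = (\<lambda>i. coord (G (S y)) i + (\<Sum>x\<in>F. (\<i> * coord (S y) x) * coord (unit_vec x) i))"
      unfolding P_sum by (simp only: coord_sum coord_cscale)
    finally have "u = (\<lambda>i. coord (G (S y)) i + (\<Sum>w\<in>(\<lambda>x. coord (unit_vec x)) ` F. c w * w i))"
      using c by metis
    moreover have "coord (G (S y)) \<in> T ` ell2"
      by (simp add: TG)
    ultimately show "\<exists>v\<in>T ` ell2. \<exists>c. u = (\<lambda>i. v i + (\<Sum>w\<in>(\<lambda>x. coord (unit_vec x)) ` F. c w * w i))"
      by blast
  qed
  moreover have "ell2_closed (T ` ell2)"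
  proof -
    define W where "W = {x - restr F (S (cscale \<i> x)) | x. restr F x = x}"
    have restr_restr: "restr F (restr F u) = restr F u" for u :: "'a l2"
      by (rule l2_eqI) simp
    have restr_cscale: "restr F (cscale c u) = cscale c (restr F u)" for u :: "'a l2" and c
      by (rule l2_eqI) simp
    have "closed W"
    proof (rule closed_finite_support_csubspace[OF F])
      show "csubspace W"
        unfolding csubspace_def
      proof (intro conjI ballI allI)
        fix u v assume "u \<in> W" "v \<in> W"
        then obtain x y where xy: "restr F x = x" "restr F y = y"
          "u = x - restr F (S (cscale \<i> x))" "v = y - restr F (S (cscale \<i> y))"
          by (auto simp: W_def)
        have "cscale \<i> (x + y) = cscale \<i> x + cscale \<i> y"
          by (rule l2_eqI) (simp add: algebra_simps)
        then have "u + v = (x + y) - restr F (S (cscale \<i> (x + y)))"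
          by (intro l2_eqI) (simp add: xy S.add)
        moreover have "restr F (x + y) = x + y"
          using xy by (simp add: bounded_linear.linear[OF bounded_linear_restr] linear_add)
        ultimately show "u + v \<in> W"
          by (auto simp: W_def)
      next
        fix u c assume "u \<in> W"
        then obtain x where x: "restr F x = x" "u = x - restr F (S (cscale \<i> x))"
          by (auto simp: W_def)
        have "cscale \<i> (cscale c x) = cscale c (cscale \<i> x)"
          by (rule l2_eqI) simp
        then have "cscale c u = cscale c x - restr F (S (cscale \<i> (cscale c x)))"
          by (intro l2_eqI) (simp add: x(2) S(2) algebra_simps)
        moreover have "restr F (cscale c x) = cscale c x"
          by (simp add: restr_cscale x(1))
        ultimately show "cscale c u \<in> W"
          by (auto simp: W_def)
      qed
      show "coord u n = 0" if "u \<in> W" "n \<notin> F" for u n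
      proof -
        obtain x where "restr F x = x" "u = x - restr F (S (cscale \<i> x))"
          using \<open>u \<in> W\<close> by (auto simp: W_def)
        then show ?thesis
          using \<open>n \<notin> F\<close> coord_restr[of F x n] by simp
      qed
    qed
    moreover have "continuous_on UNIV (\<lambda>y. restr F (S y))"
      by (intro linear_continuous_on bounded_linear_compose[OF bounded_linear_restr S(1)])
    moreover have "range G = (\<lambda>y. restr F (S y)) -` W"
    proof (intro equalityI subsetI)
      fix y assume "y \<in> range G"
      then obtain x where y: "y = A x - P x"
        by (auto simp: GA)
      have "restr F (S y) = restr F x - restr F (S (cscale \<i> (restr F x)))"
        by (simp add: y S.diff SA P_def bounded_linear.linear[OF bounded_linear_restr] linear_diff)
      then show "y \<in> (\<lambda>y. restr F (S y)) -` W"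
        using restr_restr by (auto simp: W_def)
    next
      fix y assume "y \<in> (\<lambda>y. restr F (S y)) -` W"
      then obtain \<xi> where \<xi>: "restr F \<xi> = \<xi>" "restr F (S y) = \<xi> - restr F (S (cscale \<i> \<xi>))"
        by (auto simp: W_def)
      \<comment> \<open>A solution of \<open>G x = y\<close> satisfies \<open>A x = y + P x\<close>;
        with \<xi> prescribed as its restriction to \<open>F\<close>, applying \<open>S\<close>
        leaves only this candidate.\<close>
      define x where "x = S y + S (cscale \<i> \<xi>)"
      have "restr F x = \<xi>"
        using \<xi>(2) by (simp add: x_def bounded_linear.linear[OF bounded_linear_restr] linear_add)
      moreover have "A x = y + cscale \<i> \<xi>"
        by (simp add: x_def AS flip: S.add)
      ultimately have "G x = y"
        by (simp add: GA P_def)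
      then show "y \<in> range G" by auto
    qed
    ultimately have clo: "closed (range G)"
      by (simp add: closed_vimage)
    show ?thesis
      unfolding ell2_closed_def
    proof (intro allI impI)
      fix v w
      assume v: "\<forall>k::nat. v k \<in> T ` ell2" and w: "w \<in> ell2"
        and lim: "(\<lambda>k. ell2_norm (\<lambda>i. v k i - w i)) \<longlonglongrightarrow> 0"
      obtain w' where w': "w = coord w'"
        using w by (auto simp flip: range_coord)
      have "\<forall>k. \<exists>x. x \<in> range G \<and> v k = coord x"
        using v unfolding TG by blast
      then obtain X where X: "\<And>k. X k \<in> range G" "\<And>k. v k = coord (X k)"
        by metis
      have "(\<lambda>k. norm (X k - w')) \<longlonglongrightarrow> 0"
        using lim by (simp add: norm_eq_ell2_norm X(2) w' minus_l2.rep_eq)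
      then have "X \<longlonglongrightarrow> w'"
        by (rule LIM_zero_cancel[OF tendsto_norm_zero_cancel])
      then have "w' \<in> range G"
        using closed_sequentially[OF clo X(1)] by simp
      then show "w \<in> T ` ell2"
        by (simp add: TG w')
    qed
  qed
  ultimately show ?thesis
    by (simp add: fredholm_def)
qed

lemma restr_tendsto:
  obtains F :: "nat \<Rightarrow> 'i set" where "\<And>k. finite (F k)" "(\<lambda>k. restr (F k) u) \<longlonglongrightarrow> u"
proof -
  have "\<exists>F. finite F \<and> norm (u - restr F u) < 1 / real (Suc k)" for k
    using restr_approx[of "1 / real (Suc k)" u] by auto
  then obtain F where F: "\<And>k. finite (F k)" "\<And>k. norm (u - restr (F k) u) < 1 / real (Suc k)"
    by metis
  have "(\<lambda>k. norm (restr (F k) u - u)) \<longlonglongrightarrow> 0"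
  proof (rule tendsto_sandwich[OF _ _ tendsto_const LIMSEQ_inverse_real_of_nat])
    show "\<forall>\<^sub>F k in sequentially. norm (restr (F k) u - u) \<le> inverse (real (Suc k))"
      using F(2) by (intro always_eventually allI less_imp_le) (simp add: norm_minus_commute inverse_eq_divide)
  qed auto
  then have "(\<lambda>k. restr (F k) u) \<longlonglongrightarrow> u"
    by (rule LIM_zero_cancel[OF tendsto_norm_zero_cancel])
  with F(1) show thesis by (rule that)
qed

text \<open>The failure of singularity only speaks of finitely supported vectors. Truncations still
  vanish on \<open>F\<close> and converge in norm, so the bound extends by continuity.\<close>

lemma not_singular_imp_bounded_below_outside:
  assumes "bounded_linear G" "\<not> singular_at_infinity UNIV G"
  obtains e F where "e > 0" "finite F" "\<And>u. (\<forall>n\<in>F. coord u n = 0) \<Longrightarrow> e * norm u \<le> norm (G u)"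
proof -
  interpret G: bounded_linear G by fact
  obtain e F where e: "e > 0" "finite F"
    and fs: "\<And>u. u \<noteq> 0 \<Longrightarrow> \<forall>n\<in>F. coord u n = 0 \<Longrightarrow> finite {n. coord u n \<noteq> 0} \<Longrightarrow> e * norm u \<le> norm (G u)"
    using assms(2) unfolding singular_at_infinity_def by (metis UNIV_I not_less)
  have "e * norm u \<le> norm (G u)" if u: "\<forall>n\<in>F. coord u n = 0" for u
  proof -
    obtain E where E: "\<And>k::nat. finite (E k)" "(\<lambda>k. restr (E k) u) \<longlonglongrightarrow> u"
      using restr_tendsto[of u] by metis
    have "e * norm (restr (E k) u) \<le> norm (G (restr (E k) u))" for k
    proof (cases "restr (E k) u = 0")
      case False
      then show ?thesis
        using u E(1)[of k] by (intro fs) (auto intro: finite_subset[of _ "E k"])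
    qed simp
    moreover have "(\<lambda>k. e * norm (restr (E k) u)) \<longlonglongrightarrow> e * norm u"
      by (intro tendsto_intros E)
    moreover have "(\<lambda>k. norm (G (restr (E k) u))) \<longlonglongrightarrow> norm (G u)"
      by (intro tendsto_norm G.tendsto E)
    ultimately show ?thesis
      by (intro LIMSEQ_le) auto
  qed
  with e show thesis by (rule that)
qed

lemma inner_restr: "restr F u \<bullet> v = u \<bullet> restr F v"
proof -
  have "(\<lambda>i. cnj (indicator F i)) = indicator F"
    by (auto simp: indicator_def)
  then show ?thesis
    unfolding restr_def
    by (subst inner_mult) (auto simp: bounded_iff indicator_def intro: exI[of _ 1])
qed

text \<open>
  Pairing with \<open>\<i> x\<close> shows that \<open>\<parallel>P\<^sub>F x\<parallel>\<^sup>2\<close> is at most \<open>\<parallel>(G \<plusminus> \<i> P\<^sub>F) x\<parallel> \<parallel>x\<parallel>\<close>, while \<open>G\<close> controls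
  \<open>x - P\<^sub>F x\<close>.
\<close>

lemma bounded_below_add_imaginary:
  assumes "bounded_linear G" and im: "\<And>u. G u \<bullet> cscale \<i> u = 0"
    and e: "e > 0" "\<And>u. (\<forall>n\<in>F. coord u n = 0) \<Longrightarrow> e * norm u \<le> norm (G u)"
    and s: "\<bar>s\<bar> = 1"
  shows "bounded_below (\<lambda>u. G u + s *\<^sub>R cscale \<i> (restr F u))"
proof -
  interpret G: bounded_linear G by fact
  obtain K where K: "K > 0" "\<And>x. norm (G x) \<le> norm x * K"
    using G.pos_bounded by blast
  \<comment> \<open>\<open>L\<close> collects the coefficients of the norm \<open>p\<close> of the
    part on \<open>F\<close> once \<open>e * (n - p) \<le> r + p + K * p\<close> is solved for
    \<open>e * n\<close>. \<open>M\<close> is what remains after half of \<open>e * n\<close> is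
    absorbed.\<close>
  define L where "L = 1 + K + e"
  define M where "M = 1 + L\<^sup>2 / (2 * e)"
  have M: "M > 0"
    using e(1) by (auto simp: M_def intro: add_pos_nonneg)
  have "e / 2 / M * norm x \<le> norm (G x + s *\<^sub>R cscale \<i> (restr F x))" for x
  proof -
    define r p n where "r = norm (G x + s *\<^sub>R cscale \<i> (restr F x))"
      and "p = norm (restr F x)" and "n = norm x"
    have nn: "0 \<le> r" "0 \<le> p" "0 \<le> n"
      by (auto simp: r_def p_def n_def)
    have "cscale (- \<i>) (cscale \<i> x) = x"
      by (rule l2_eqI) simp
    then have "(G x + s *\<^sub>R cscale \<i> (restr F x)) \<bullet> cscale \<i> x = s * (restr F x \<bullet> x)"
      using im[of x] by (simp add: inner_add_left inner_mult)
    also have "restr F x \<bullet> x = p\<^sup>2"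
    proof -
      have "restr F x = restr F (restr F x)"
        by (rule l2_eqI) simp
      then show ?thesis
        by (metis inner_restr p_def power2_norm_eq_inner)
    qed
    finally have "p\<^sup>2 = \<bar>(G x + s *\<^sub>R cscale \<i> (restr F x)) \<bullet> cscale \<i> x\<bar>"
      using s by (simp add: abs_mult)
    also have "\<dots> \<le> r * n"
      using Cauchy_Schwarz_ineq2[of "G x + s *\<^sub>R cscale \<i> (restr F x)" "cscale \<i> x"]
      by (simp add: norm_cscale r_def n_def)
    finally have p2: "p\<^sup>2 \<le> r * n" .
    have "e * (n - p) \<le> e * norm (x - restr F x)"
      using e(1) norm_triangle_ineq2[of x "restr F x"] by (simp add: n_def p_def)
    also have "\<dots> \<le> norm (G (x - restr F x))"
      by (rule e(2)) simp
    also have "\<dots> \<le> r + p + K * p"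
    proof -
      have "G (x - restr F x) = (G x + s *\<^sub>R cscale \<i> (restr F x)) - s *\<^sub>R cscale \<i> (restr F x) - G (restr F x)"
        by (simp add: G.diff)
      also have "norm \<dots> \<le> r + norm (s *\<^sub>R cscale \<i> (restr F x)) + norm (G (restr F x))"
        unfolding r_def
        using norm_triangle_ineq4[of "G x + s *\<^sub>R cscale \<i> (restr F x) - s *\<^sub>R cscale \<i> (restr F x)"
            "G (restr F x)"]
          norm_triangle_ineq4[of "G x + s *\<^sub>R cscale \<i> (restr F x)" "s *\<^sub>R cscale \<i> (restr F x)"]
        by linarith
      also have "\<dots> \<le> r + p + K * p"
        using s K(2)[of "restr F x"] by (simp add: p_def norm_cscale mult.commute)
      finally show ?thesis .
    qed
    finally have 1: "e * n \<le> r + L * p"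
      by (simp add: L_def algebra_simps)
    \<comment> \<open>Arithmetic-geometric mean inequality, with the product split so that one
      summand is exactly \<open>e * n / 2\<close>.\<close>
    have "(L * p)\<^sup>2 \<le> L\<^sup>2 * (r * n)"
      unfolding power_mult_distrib using p2 by (intro mult_left_mono) auto
    also have "\<dots> = 4 * (e * n / 2) * (L\<^sup>2 * r / (2 * e))"
      using e(1) by simp
    also have "\<dots> \<le> (e * n / 2 + L\<^sup>2 * r / (2 * e))\<^sup>2"
      using zero_le_power2[of "e * n / 2 - L\<^sup>2 * r / (2 * e)"]
      unfolding power2_sum power2_diff by linarith
    finally have "L * p \<le> e * n / 2 + L\<^sup>2 * r / (2 * e)"
      using e(1) nn by (intro power2_le_imp_le[of "L * p"]) auto
    have "e / 2 * n \<le> r * M"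
    proof -
      have "r * M = r + L\<^sup>2 * r / (2 * e)"
        by (simp add: M_def algebra_simps)
      moreover have "e * n / 2 + e / 2 * n = e * n"
        by simp
      ultimately show ?thesis
        using 1 \<open>L * p \<le> e * n / 2 + L\<^sup>2 * r / (2 * e)\<close> by linarith
    qed
    then show ?thesis
      using M by (simp add: r_def n_def field_simps)
  qed
  then show ?thesis
    unfolding bounded_below_def using e(1) M by (intro exI[of _ "e / 2 / M"]) auto
qed

text \<open>The signs s = 1 and s = -1 give an operator and its adjoint. Both are bounded below, so
  the first is onto and \<open>G\<close> is a finite-rank perturbation of it.\<close>

lemma not_singular_imp_fredholm:
  assumes T: "\<And>u. T (coord u) = coord (G u)"
    and G: "bounded_linear G" "\<And>c u. G (cscale c u) = cscale c (G u)"
    and sym: "\<And>x y. G x \<bullet> y = x \<bullet> G y" and "\<not> singular_at_infinity UNIV G"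
  shows "fredholm T"
proof -
  have im: "G u \<bullet> cscale \<i> u = 0" for u
  proof -
    have "G u \<bullet> cscale \<i> u = cscale (- \<i>) u \<bullet> G u"
      using sym[of u "cscale \<i> u"] by (simp add: G(2) inner_mult)
    then show ?thesis
      by (simp add: cscale_minus inner_commute)
  qed
  obtain e F where e: "e > 0" "finite F" "\<And>u. (\<forall>n\<in>F. coord u n = 0) \<Longrightarrow> e * norm u \<le> norm (G u)"
    using not_singular_imp_bounded_below_outside[OF G(1) assms(5)] by metis
  have bl: "bounded_linear (\<lambda>u. G u + s *\<^sub>R cscale \<i> (restr F u))" for s
    by (intro bounded_linear_add G bounded_linear_compose[OF bounded_linear_scaleR_right]
        bounded_linear_compose[OF bounded_linear_mult bounded_linear_restr]) auto
  have bb: "bounded_below (\<lambda>u. G u + s *\<^sub>R cscale \<i> (restr F u))" if "\<bar>s\<bar> = 1" for s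
    using bounded_below_add_imaginary[OF G(1) im e(1,3) that] .
  have adj: "(G x + 1 *\<^sub>R cscale \<i> (restr F x)) \<bullet> y = x \<bullet> (G y + (- 1) *\<^sub>R cscale \<i> (restr F y))" for x y
  proof -
    have "restr F (cscale (- \<i>) y) = (- 1) *\<^sub>R cscale \<i> (restr F y)"
      by (rule l2_eqI) simp
    then have "cscale \<i> (restr F x) \<bullet> y = x \<bullet> ((- 1) *\<^sub>R cscale \<i> (restr F y))"
      by (simp add: inner_mult inner_restr)
    then show ?thesis
      unfolding inner_add_left inner_add_right sym scaleR_one by simp
  qed
  have "surj (\<lambda>u. G u + 1 *\<^sub>R cscale \<i> (restr F u))"
    by (rule bounded_below_imp_surj[OF bl bl adj bb bb]) auto
  then show ?thesis
    using bb[of 1] by (intro fredholmI[OF T G e(2)]) auto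
qed

lemma norm_jacobi_op_ge_Im:
  assumes "bounded_bonds a" "bounded (range b)"
  shows "\<bar>Im z\<bar> * norm u \<le> norm (jacobi_op a (\<lambda>n. of_real (b n) - z) u)"
proof (rule power2_le_imp_le)
  show "(\<bar>Im z\<bar> * norm u)\<^sup>2 \<le> (norm (jacobi_op a (\<lambda>n. of_real (b n) - z) u))\<^sup>2"
    unfolding norm_jacobi_op_shift[OF assms] power_mult_distrib by simp
qed simp

lemma singular_jacobi_imp_real:
  assumes "bounded_bonds a" "bounded (range b)"
    and "singular_at_infinity UNIV (jacobi_op a (\<lambda>n. of_real (b n) - z))"
  shows "Im z = 0"
proof (rule ccontr)
  assume "Im z \<noteq> 0"
  then obtain u where "norm (jacobi_op a (\<lambda>n. of_real (b n) - z) u) < \<bar>Im z\<bar> * norm u"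
    using assms(3) unfolding singular_at_infinity_def
    by (elim allE[of _ "\<bar>Im z\<bar>"] impE allE[of _ "{}"]) auto
  then show False
    using norm_jacobi_op_ge_Im[OF assms(1,2), of z u] by simp
qed

text \<open>The symmetric theory applies to real z only. For other z the imaginary part is a lower
  bound for J - z and for its adjoint, so both sides of the equivalence are false.\<close>

lemma essential_spectrum_jacobi:
  assumes "bounded_bonds a" "bounded (range b)"
  shows "z \<in> essential_spectrum (jacobi a b)
    \<longleftrightarrow> singular_at_infinity UNIV (jacobi_op a (\<lambda>n. of_real (b n) - z))"
proof -
  define G where "G = jacobi_op a (\<lambda>n. of_real (b n) - z)"
  have b: "bounded (range (\<lambda>n. complex_of_real (b n) - z))" for z
    using bounded_range_shift[OF assms(2)] .
  have T: "shift_by (jacobi a b) z (coord u) = coord (G u)" for u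
    unfolding G_def by (rule jacobi_coord[OF assms])
  have G: "bounded_linear G" "G (cscale c u) = cscale c (G u)" for c u
    unfolding G_def by (rule bounded_linear_jacobi_op[OF assms(1) b], rule jacobi_op_cscale[OF assms(1) b])
  show ?thesis
  proof (cases "Im z = 0")
    case True
    then have "cnj z = z" by (simp add: complex_eq_iff)
    then have sym: "G x \<bullet> y = x \<bullet> G y" for x y
      using inner_jacobi_op[OF assms(1) b, of z] by (simp add: G_def)
    show ?thesis
      unfolding essential_spectrum_def mem_Collect_eq G_def[symmetric]
      using singular_at_infinity_imp_not_fredholm[of _ G, OF T G sym]
        not_singular_imp_fredholm[of _ G, OF T G sym] by blast
  next
    case False
    have "bounded_below G"
      unfolding bounded_below_def G_def
      using False norm_jacobi_op_ge_Im[OF assms, of z] by (intro exI[of _ "\<bar>Im z\<bar>"]) auto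
    moreover have "bounded_below (jacobi_op a (\<lambda>n. of_real (b n) - cnj z))"
      unfolding bounded_below_def
      using False norm_jacobi_op_ge_Im[OF assms, of "cnj z"] by (intro exI[of _ "\<bar>Im z\<bar>"]) auto
    ultimately have "bounded_below G" "surj G"
      using bounded_below_imp_surj[OF G(1) bounded_linear_jacobi_op[OF assms(1) b, of "cnj z"]]
        inner_jacobi_op[OF assms(1) b, of z] by (simp_all add: G_def)
    moreover have "G u + cscale \<i> (restr {} u) = G u" for u
      by (rule l2_eqI) simp
    ultimately have "fredholm (shift_by (jacobi a b) z)"
      by (intro fredholmI[of _ G, OF T G, of "{}"]) auto
    moreover have "\<not> singular_at_infinity UNIV G"
      using False singular_jacobi_imp_real[OF assms] by (auto simp: G_def)
    ultimately show ?thesis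
      by (simp add: essential_spectrum_def G_def)
  qed
qed


section \<open>Limits of translates\<close>

text \<open>The coefficients converge only pointwise. A common finite support \<open>Q\<close>
  confines all images to the finite set \<open>M\<close>, which is \<open>Q\<close> enlarged by one
  step, and the norms become finite sums of convergent terms.\<close>

lemma norm_jacobi_op_tendsto:
  assumes bd: "\<And>j::nat. bounded_bonds (a j)" "\<And>j. bounded (range (w j))"
      "bounded_bonds a'" "bounded (range w')"
    and Q: "finite Q" "\<And>j n. n \<notin> Q \<Longrightarrow> coord (u j) n = 0" "\<And>n. n \<notin> Q \<Longrightarrow> coord u' n = 0"
    and lim: "\<And>k l. adjacent k l \<Longrightarrow> (\<lambda>j. a j {l, k}) \<longlonglongrightarrow> a' {l, k}"
      "\<And>n. (\<lambda>j. w j n) \<longlonglongrightarrow> w' n" "\<And>n. (\<lambda>j. coord (u j) n) \<longlonglongrightarrow> coord u' n"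
  shows "(\<lambda>j. norm (jacobi_op (a j) (w j) (u j))) \<longlonglongrightarrow> norm (jacobi_op a' w' u')"
proof -
  define M where "M = Q \<union> (\<Union>d\<in>unit_steps. (\<lambda>q. q - d) ` Q)"
  have M: "finite M"
    using Q(1) finite_unit_steps by (auto simp: M_def)
  have out: "n \<notin> Q \<and> (\<forall>d\<in>unit_steps. n + d \<notin> Q)" if "n \<notin> M" for n
    using that by (force simp: M_def image_iff)
  have norm_eq: "norm (jacobi_op A W U) = sqrt (\<Sum>n\<in>M. (cmod (coord (jacobi_op A W U) n))\<^sup>2)"
    if "bounded_bonds A" "bounded (range W)" "\<And>n. n \<notin> Q \<Longrightarrow> coord U n = 0" for A W U
    using out that
    by (subst norm_l2_finite_support[OF M, symmetric]) (auto simp: coord_jacobi_op)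
  have "norm (jacobi_op (a j) (w j) (u j))
      = sqrt (\<Sum>n\<in>M. (cmod (coord (jacobi_op (a j) (w j) (u j)) n))\<^sup>2)" for j
    using bd(1,2) Q(2) by (rule norm_eq)
  moreover have "norm (jacobi_op a' w' u') = sqrt (\<Sum>n\<in>M. (cmod (coord (jacobi_op a' w' u') n))\<^sup>2)"
    using bd(3,4) Q(3) by (rule norm_eq)
  ultimately show ?thesis
    by (simp only: coord_jacobi_op[OF bd(1,2)] coord_jacobi_op[OF bd(3,4)]) (intro tendsto_intros lim, simp)
qed

lemma bounded_limit_coefficients:
  assumes "bounded_bonds a" "bounded (range b)"
    and b': "\<And>l. (\<lambda>j::nat. b (p j + l)) \<longlonglongrightarrow> b' l"
    and a': "\<And>k l. adjacent k l \<Longrightarrow> (\<lambda>j. a {p j + l, p j + k}) \<longlonglongrightarrow> a' {k, l}"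
  shows "bounded_bonds a'" "bounded (range (b' :: int ^ 'n \<Rightarrow> real))"
proof -
  obtain C where C: "\<And>m n. adjacent m n \<Longrightarrow> \<bar>a {n, m}\<bar> \<le> C"
    using assms(1) by (auto simp: bounded_bonds_def)
  have "\<bar>a' {l, k}\<bar> \<le> C" if "adjacent k l" for k l
  proof (rule Lim_bounded)
    show "(\<lambda>j. \<bar>a {p j + l, p j + k}\<bar>) \<longlonglongrightarrow> \<bar>a' {l, k}\<bar>"
      using a'[OF that] by (intro tendsto_intros) (simp add: insert_commute)
    show "\<forall>j\<ge>0. \<bar>a {p j + l, p j + k}\<bar> \<le> C"
      using that by (auto intro!: C simp: adjacent_iff_unit_steps)
  qed
  then show "bounded_bonds a'"
    by (auto simp: bounded_bonds_def)
  obtain B where B: "\<And>n. \<bar>b n\<bar> \<le> B"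
    using assms(2) by (auto simp: bounded_iff)
  have "\<bar>b' l\<bar> \<le> B" for l
  proof (rule Lim_bounded)
    show "(\<lambda>j. \<bar>b (p j + l)\<bar>) \<longlonglongrightarrow> \<bar>b' l\<bar>"
      by (intro tendsto_intros b')
    show "\<forall>j\<ge>0. \<bar>b (p j + l)\<bar> \<le> B"
      using B by simp
  qed
  then show "bounded (range b')"
    by (auto simp: bounded_iff)
qed

text \<open>Serves both inclusions: with a constant sequence \<open>u\<close> it carries a test
  vector of the limit point out to infinity, with a convergent one it brings far-away vectors
  back.\<close>

lemma norm_jacobi_op_translates_tendsto:
  assumes "bounded_bonds a" "bounded (range b)"
    and b': "\<And>l. (\<lambda>j::nat. b (p j + l)) \<longlonglongrightarrow> b' l"
    and a': "\<And>k l. adjacent k l \<Longrightarrow> (\<lambda>j. a {p j + l, p j + k}) \<longlonglongrightarrow> a' {k, l}"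
    and Q: "finite Q" "\<And>j n. n \<notin> Q \<Longrightarrow> coord (u j) n = 0" "\<And>n. n \<notin> Q \<Longrightarrow> coord u' n = 0"
    and u: "\<And>n. (\<lambda>j. coord (u j) n) \<longlonglongrightarrow> coord u' n"
  shows "(\<lambda>j. norm (jacobi_op a (\<lambda>n. of_real (b n) - z) (transl (- p j) (u j))))
    \<longlonglongrightarrow> norm (jacobi_op a' (\<lambda>n. of_real (b' n) - z) u')"
proof -
  have b: "bounded (range (\<lambda>n. complex_of_real (b n) - z))"
    by (rule bounded_range_shift[OF assms(2)])
  have "norm (jacobi_op a (\<lambda>n. of_real (b n) - z) (transl (- p j) (u j)))
      = norm (jacobi_op (\<lambda>s. a ((+) (p j) ` s)) (\<lambda>n. of_real (b (p j + n)) - z) (u j))" for j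
    using arg_cong[OF transl_jacobi_op(1)[OF assms(1) b, of "p j" "transl (- p j) (u j)"], of norm]
    by simp
  moreover have "(\<lambda>j. norm (jacobi_op (\<lambda>s. a ((+) (p j) ` s)) (\<lambda>n. of_real (b (p j + n)) - z) (u j)))
      \<longlonglongrightarrow> norm (jacobi_op a' (\<lambda>n. of_real (b' n) - z) u')"
  proof (rule norm_jacobi_op_tendsto[OF _ _ _ _ Q _ _ u])
    show "bounded_bonds (\<lambda>s. a ((+) (p j) ` s))" "bounded (range (\<lambda>n. complex_of_real (b (p j + n)) - z))" for j
      using transl_jacobi_op(2,3)[OF assms(1) b] by auto
    show "bounded_bonds a'" "bounded (range (\<lambda>n. complex_of_real (b' n) - z))"
      using bounded_limit_coefficients[OF assms(1,2) b' a'] bounded_range_shift by auto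
    show "(\<lambda>j. a ((+) (p j) ` {l, k})) \<longlonglongrightarrow> a' {l, k}" if "adjacent k l" for k l
      using a'[OF that] by (simp add: insert_commute)
    show "(\<lambda>j. complex_of_real (b (p j + n)) - z) \<longlonglongrightarrow> of_real (b' n) - z" for n
      by (intro tendsto_intros b')
  qed
  ultimately show ?thesis
    by simp
qed

lemma jacobi_op_shift_const:
  assumes "bounded_bonds a" "bounded (range b)"
  shows "jacobi_op a (\<lambda>n. of_real (b n) - (z + c)) u
    = jacobi_op a (\<lambda>n. of_real (b n) - z) u - cscale c u"
proof -
  have "(\<lambda>n. of_real (b n) - (z + c)) = (\<lambda>n. (of_real (b n) - z) + - c)"
    by (simp add: algebra_simps)
  then show ?thesis
    using jacobi_op_add_potential[OF assms(1) bounded_range_shift[OF assms(2)], of "\<lambda>_. - c" z u]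
    by (simp add: cscale_minus)
qed

lemma closure_limit_spectra_imp_singular:
  assumes "bounded_bonds a" "bounded (range b)"
    and z: "z \<in> closure (\<Union>e \<in> sphere (0 :: real ^ 'n) 1. \<Union>T \<in> limit_points a b e. spectrum T)"
  shows "singular_at_infinity UNIV (jacobi_op a (\<lambda>n. of_real (b n) - z))"
  unfolding singular_at_infinity_def
proof (intro allI impI)
  fix e :: real and F :: "(int ^ 'n) set"
  assume e: "e > 0" and F: "finite F"
  obtain y T v where y: "T \<in> limit_points a b v" "y \<in> spectrum T" "dist y z < e / 2"
    using z e unfolding closure_approachable by (metis UN_E half_gt_zero)
  obtain a' b' p where T: "T = jacobi a' b'"
    and p: "filterlim (\<lambda>j. norm (lattice_vec (p j))) at_top sequentially"
    and b': "\<And>l. (\<lambda>j::nat. b (p j + l)) \<longlonglongrightarrow> b' l"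
    and a': "\<And>k l. adjacent k l \<Longrightarrow> (\<lambda>j. a {p j + l, p j + k}) \<longlonglongrightarrow> a' {k, l}"
    using y(1) by (auto simp: limit_points_def)
  have bd': "bounded_bonds a'" "bounded (range b')"
    using bounded_limit_coefficients[OF assms(1,2) b' a'] by auto
  define G' where "G' = jacobi_op a' (\<lambda>n. of_real (b' n) - z)"
  have "\<not> bounded_below (jacobi_op a' (\<lambda>n. of_real (b' n) - y))"
    using y(2) by (simp add: T spectrum_jacobi[OF bd'])
  then obtain u where u: "norm (jacobi_op a' (\<lambda>n. of_real (b' n) - y) u) < e / 2 * norm u"
    using e unfolding bounded_below_def by (meson half_gt_zero not_less)
  \<comment> \<open>Half of the error budget is spent on replacing \<open>y\<close> by
    \<open>z\<close>, the other half on the approximate eigenvector at \<open>y\<close>. The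
    resulting strict inequality survives truncation and translation.\<close>
  have "G' u = jacobi_op a' (\<lambda>n. of_real (b' n) - y) u - cscale (z - y) u"
    using jacobi_op_shift_const[OF bd', of y "z - y" u] by (simp add: G'_def)
  then have "norm (G' u) \<le> norm (jacobi_op a' (\<lambda>n. of_real (b' n) - y) u) + cmod (z - y) * norm u"
    by (metis norm_cscale norm_triangle_ineq4)
  also have "cmod (z - y) * norm u \<le> e / 2 * norm u"
    using y(3) by (intro mult_right_mono) (auto simp: dist_norm norm_minus_commute)
  finally have G'u: "norm (G' u) < e * norm u"
    using u by simp
  interpret G': bounded_linear G'
    unfolding G'_def by (rule bounded_linear_jacobi_op[OF bd'(1) bounded_range_shift[OF bd'(2)]])
  obtain E where E: "\<And>k::nat. finite (E k)" "(\<lambda>k. restr (E k) u) \<longlonglongrightarrow> u"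
    using restr_tendsto[of u] by metis
  have "(\<lambda>k. e * norm (restr (E k) u) - norm (G' (restr (E k) u))) \<longlonglongrightarrow> e * norm u - norm (G' u)"
    by (intro tendsto_intros G'.tendsto E)
  then have "\<forall>\<^sub>F k in sequentially. 0 < e * norm (restr (E k) u) - norm (G' (restr (E k) u))"
    by (rule order_tendstoD) (use G'u in simp)
  then obtain k where k: "0 < e * norm (restr (E k) u) - norm (G' (restr (E k) u))"
    using eventually_happens'[OF sequentially_bot] by blast
  define x where "x = restr (E k) u"
  have x: "norm (G' x) < e * norm x" "\<And>n. n \<notin> E k \<Longrightarrow> coord x n = 0"
    using k by (auto simp: x_def)
  have "(\<lambda>j. norm (jacobi_op a (\<lambda>n. of_real (b n) - z) (transl (- p j) x))) \<longlonglongrightarrow> norm (G' x)"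
    unfolding G'_def
    by (rule norm_jacobi_op_translates_tendsto[OF assms(1,2) b' a' E(1)[of k]]) (use x(2) in auto)
  then have ev1: "\<forall>\<^sub>F j in sequentially.
      norm (jacobi_op a (\<lambda>n. of_real (b n) - z) (transl (- p j) x)) < e * norm x"
    by (rule order_tendstoD) (rule x(1))
  \<comment> \<open>The translated support can meet \<open>F\<close> only if \<open>p j\<close> is
    one of finitely many differences, and these are left behind because the norms of
    \<open>p j\<close> tend to infinity.\<close>
  have "\<forall>\<^sub>F j in sequentially. \<forall>r\<in>(\<lambda>(n, q). n - q) ` (F \<times> E k). p j \<noteq> r"
  proof (rule eventually_ball_finite)
    show "\<forall>r\<in>(\<lambda>(n, q). n - q) ` (F \<times> E k). \<forall>\<^sub>F j in sequentially. p j \<noteq> r"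
    proof
      fix r :: "int ^ 'n"
      have "\<forall>\<^sub>F j in sequentially. norm (lattice_vec r) < norm (lattice_vec (p j))"
        using p by (simp add: filterlim_at_top_dense)
      then show "\<forall>\<^sub>F j in sequentially. p j \<noteq> r"
        by (rule eventually_mono) auto
    qed
  qed (use F E(1) in auto)
  with ev1 have "\<forall>\<^sub>F j in sequentially.
      norm (jacobi_op a (\<lambda>n. of_real (b n) - z) (transl (- p j) x)) < e * norm x
      \<and> (\<forall>r\<in>(\<lambda>(n, q). n - q) ` (F \<times> E k). p j \<noteq> r)"
    by (rule eventually_conj)
  then obtain j where j: "norm (jacobi_op a (\<lambda>n. of_real (b n) - z) (transl (- p j) x)) < e * norm x"
      "\<forall>r\<in>(\<lambda>(n, q). n - q) ` (F \<times> E k). p j \<noteq> r"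
    using eventually_happens'[OF sequentially_bot] by blast
  show "\<exists>u\<in>UNIV. u \<noteq> 0 \<and> (\<forall>n\<in>F. coord u n = 0) \<and> finite {n. coord u n \<noteq> 0}
      \<and> norm (jacobi_op a (\<lambda>n. of_real (b n) - z) u) < e * norm u"
  proof (intro bexI conjI)
    have "norm x > 0"
      using x(1) e by (metis mult_zero_right norm_ge_zero not_less zero_less_norm_iff norm_zero)
    then show "transl (- p j) x \<noteq> 0"
      by (metis norm_transl norm_zero less_irrefl)
    show "\<forall>n\<in>F. coord (transl (- p j) x) n = 0"
    proof
      fix n assume "n \<in> F"
      have "n - p j \<notin> E k"
      proof
        assume "n - p j \<in> E k"
        then have "n - (n - p j) \<in> (\<lambda>(n, q). n - q) ` (F \<times> E k)"
          using \<open>n \<in> F\<close> by blast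
        then have "p j \<in> (\<lambda>(n, q). n - q) ` (F \<times> E k)"
          by (simp only: diff_diff_eq2 add_diff_cancel_left')
        then show False
          using j(2) by blast
      qed
      then show "coord (transl (- p j) x) n = 0"
        by (simp add: x(2))
    qed
    show "finite {n. coord (transl (- p j) x) n \<noteq> 0}"
    proof (rule finite_subset)
      show "{n. coord (transl (- p j) x) n \<noteq> 0} \<subseteq> (\<lambda>q. q + p j) ` E k"
      proof
        fix n assume "n \<in> {n. coord (transl (- p j) x) n \<noteq> 0}"
        then have "n - p j \<in> E k"
          using x(2)[of "n - p j"] by auto
        then show "n \<in> (\<lambda>q. q + p j) ` E k"
          by (rule rev_image_eqI) simp
      qed
    qed (use E(1) in auto)
    show "norm (jacobi_op a (\<lambda>n. of_real (b n) - z) (transl (- p j) x)) < e * norm (transl (- p j) x)"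
      using j(1) by simp
  qed simp
qed

section \<open>Localization\<close>

definition cube :: "nat \<Rightarrow> (int ^ 'n) set" where
  "cube k = {m. \<forall>i. \<bar>m $ i\<bar> \<le> int k}"

lemma finite_cube: "finite (cube k :: (int ^ 'n) set)"
  and card_cube: "card (cube k :: (int ^ 'n) set) = (2 * k + 1) ^ CARD('n)"
proof -
  have eq: "(cube k :: (int ^ 'n) set) = vec_lambda ` (PiE UNIV (\<lambda>_. {- int k..int k}))"
  proof (intro equalityI subsetI)
    fix m :: "int ^ 'n" assume "m \<in> cube k"
    then have "vec_nth m \<in> PiE UNIV (\<lambda>_. {- int k..int k})"
      by (auto simp: cube_def abs_le_iff minus_le_iff)
    then show "m \<in> vec_lambda ` (PiE UNIV (\<lambda>_. {- int k..int k}))"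
      by (rule rev_image_eqI) simp
  qed (auto simp: cube_def PiE_def Pi_def abs_le_iff minus_le_iff)
  show "finite (cube k :: (int ^ 'n) set)"
    unfolding eq by (intro finite_imageI finite_PiE) auto
  have "inj (vec_lambda :: ('n \<Rightarrow> int) \<Rightarrow> _)"
    by (rule injI) (simp add: vec_lambda_inject)
  then show "card (cube k :: (int ^ 'n) set) = (2 * k + 1) ^ CARD('n)"
  proof -
    have "card {- int k..int k} = 2 * k + 1"
      by (simp add: nat_add_distrib nat_mult_distrib)
    with \<open>inj _\<close> show ?thesis
      unfolding eq by (subst card_image) (auto simp: card_PiE intro: inj_on_subset)
  qed
qed

lemma cube_add_unit_step:
  assumes "m \<in> cube k" "d \<in> unit_steps"
  shows "m + d \<in> cube (Suc k)"
proof -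
  have d: "\<bar>d $ i\<bar> \<le> 1" for i
  proof -
    have "\<bar>real_of_int (d $ i)\<bar> \<le> 1"
      using component_le_norm_cart[of "lattice_vec d" i] assms(2)
      by (simp add: unit_steps_def adjacent_def lattice_vec_def)
    then show ?thesis by linarith
  qed
  have "\<bar>m $ i + d $ i\<bar> \<le> int (Suc k)" for i
  proof -
    have "\<bar>m $ i\<bar> \<le> int k"
      using assms(1) by (simp add: cube_def)
    then show ?thesis
      using d[of i] abs_triangle_ineq[of "m $ i" "d $ i"] by simp
  qed
  then show ?thesis
    by (simp add: cube_def)
qed

text \<open>If m and m + d are separated by the boundary of the cube, one of them lies in the shell
  between \<open>cube k\<close> and \<open>cube (Suc k)\<close>. The relative size of the shell is
  \<open>((2 * k + 3) / (2 * k + 1)) ^ CARD('n) - 1\<close> and tends to 0; it is made at most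
  \<delta>/2 because two translates of it are needed.\<close>

lemma cube_Folner:
  assumes "\<delta> > 0"
  shows "\<exists>k. \<forall>d\<in>(unit_steps :: (int ^ 'n) set).
    finite {m. (m + d \<in> cube k) \<noteq> (m \<in> cube k)} \<and>
    real (card {m. (m + d \<in> cube k) \<noteq> (m \<in> cube k)}) \<le> \<delta> * real (card (cube k :: (int ^ 'n) set))"
proof -
  let ?Q = "cube :: nat \<Rightarrow> (int ^ 'n) set"
  have "(\<lambda>k. ((2 * real k + 3) / (2 * real k + 1)) ^ CARD('n)) \<longlonglongrightarrow> 1 ^ CARD('n)"
  proof (rule tendsto_power)
    have "filterlim (\<lambda>k. 2 * real k + 1) at_top sequentially"
      by (rule filterlim_at_top_mono[OF filterlim_real_sequentially]) simp
    then have "(\<lambda>k. 1 + 2 * inverse (2 * real k + 1)) \<longlonglongrightarrow> 1 + 2 * 0"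
      by (intro tendsto_intros tendsto_inverse_0_at_top)
    moreover have "(2 * real k + 3) / (2 * real k + 1) = 1 + 2 * inverse (2 * real k + 1)" for k
      by (simp add: field_simps)
    ultimately show "(\<lambda>k. (2 * real k + 3) / (2 * real k + 1)) \<longlonglongrightarrow> 1"
      by simp
  qed
  then have "\<forall>\<^sub>F k in sequentially. ((2 * real k + 3) / (2 * real k + 1)) ^ CARD('n) < 1 + \<delta> / 2"
    by (rule order_tendstoD) (use assms in simp)
  then obtain k where k: "((2 * real k + 3) / (2 * real k + 1)) ^ CARD('n) < 1 + \<delta> / 2"
    using eventually_happens'[OF sequentially_bot] by blast
  have sub: "?Q k \<subseteq> ?Q (Suc k)"
    by (auto simp: cube_def intro: order_trans[of _ "int k"])
  have "real (card (?Q (Suc k))) \<le> (1 + \<delta> / 2) * real (card (?Q k))"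
    using k by (simp add: card_cube power_divide divide_less_eq add.commute less_imp_le)
  then have diff: "real (card (?Q (Suc k) - ?Q k)) \<le> \<delta> / 2 * real (card (?Q k))"
    using card_mono[OF finite_cube sub]
    by (simp add: card_Diff_subset[OF finite_cube sub] of_nat_diff algebra_simps)
  show ?thesis
  proof (intro exI[of _ k] ballI)
    fix d :: "int ^ 'n" assume d: "d \<in> unit_steps"
    define X where "X = ?Q (Suc k) - ?Q k"
    have X: "finite X"
      by (simp add: X_def finite_cube)
    have inc: "{m. (m + d \<in> ?Q k) \<noteq> (m \<in> ?Q k)} \<subseteq> X \<union> (\<lambda>m. m - d) ` X"
    proof
      fix m assume "m \<in> {m. (m + d \<in> ?Q k) \<noteq> (m \<in> ?Q k)}"
      then consider "m + d \<in> ?Q k" "m \<notin> ?Q k" | "m + d \<notin> ?Q k" "m \<in> ?Q k"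
        by auto
      then show "m \<in> X \<union> (\<lambda>m. m - d) ` X"
      proof cases
        case 1
        then show ?thesis
          using cube_add_unit_step[of "m + d" k "- d"] d by (simp add: X_def)
      next
        case 2
        then have "m + d \<in> X"
          using cube_add_unit_step[of m k d] d by (simp add: X_def)
        then have "m \<in> (\<lambda>m. m - d) ` X"
          by (rule rev_image_eqI) simp
        then show ?thesis by simp
      qed
    qed
    have "card {m. (m + d \<in> ?Q k) \<noteq> (m \<in> ?Q k)} \<le> card X + card X"
      using card_mono[OF _ inc] card_Un_le[of X "(\<lambda>m. m - d) ` X"] card_image_le[OF X, of "\<lambda>m. m - d"] X
      by simp
    then show "finite {m. (m + d \<in> ?Q k) \<noteq> (m \<in> ?Q k)} \<and>
        real (card {m. (m + d \<in> ?Q k) \<noteq> (m \<in> ?Q k)}) \<le> \<delta> * real (card (?Q k))"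
      using finite_subset[OF inc] X diff by (simp add: X_def)
  qed
qed

lemma cmod_sum_squared_le:
  "(cmod (\<Sum>x\<in>A. f x))\<^sup>2 \<le> real (card A) * (\<Sum>x\<in>A. (cmod (f x))\<^sup>2)"
proof -
  have "(cmod (\<Sum>x\<in>A. f x))\<^sup>2 \<le> (\<Sum>x\<in>A. cmod (f x))\<^sup>2"
    by (intro power_mono norm_sum) auto
  also have "\<dots> \<le> real (card A) * (\<Sum>x\<in>A. (cmod (f x))\<^sup>2)"
    using Cauchy_Schwarz_ineq_sum[of "\<lambda>_. 1" "\<lambda>x. cmod (f x)" A] by simp
  finally show ?thesis .
qed

lemma card_translates:
  assumes "finite Q"
  shows "card {p. n - p \<in> Q} = card Q" "finite {p. n - p \<in> (Q :: 'a::ab_group_add set)}"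
proof -
  have eq: "{p. n - p \<in> Q} = (\<lambda>q. n - q) ` Q"
    by (auto intro: rev_image_eqI)
  show "card {p. n - p \<in> Q} = card Q" "finite {p. n - p \<in> Q}"
    unfolding eq using assms by (auto intro!: card_image inj_onI)
qed

lemma sum_if_card:
  assumes "finite P"
  shows "(\<Sum>p\<in>P. if R p then c else 0) = real (card {p\<in>P. R p}) * (c::real)"
  using assms by (simp add: sum.If_cases Int_def)

lemma sum_swap3:
  "(\<Sum>p\<in>P. \<Sum>n\<in>M. \<Sum>d\<in>D. f p n d) = (\<Sum>d\<in>D. \<Sum>n\<in>M. \<Sum>p\<in>P. f p n d)"
proof -
  have "(\<Sum>p\<in>P. \<Sum>n\<in>M. \<Sum>d\<in>D. f p n d) = (\<Sum>p\<in>P. \<Sum>d\<in>D. \<Sum>n\<in>M. f p n d)"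
    by (intro sum.cong refl sum.swap)
  also have "\<dots> = (\<Sum>d\<in>D. \<Sum>p\<in>P. \<Sum>n\<in>M. f p n d)"
    by (rule sum.swap)
  also have "\<dots> = (\<Sum>d\<in>D. \<Sum>n\<in>M. \<Sum>p\<in>P. f p n d)"
    by (intro sum.cong refl sum.swap)
  finally show ?thesis .
qed

text \<open>
  With \<open>\<chi>\<^sub>p\<close> the indicator of \<open>p + Q\<close>, the sums of \<open>\<parallel>\<chi>\<^sub>p u\<parallel>\<^sup>2\<close> and \<open>\<parallel>\<chi>\<^sub>p J u\<parallel>\<^sup>2\<close> over \<open>p\<close> are
  \<open>card Q\<close> times \<open>\<parallel>u\<parallel>\<^sup>2\<close> and \<open>\<parallel>J u\<parallel>\<^sup>2\<close>, while the commutators \<open>[J, \<chi>\<^sub>p] u\<close> only see the boundary of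
  \<open>Q\<close>. Hence some \<open>\<chi>\<^sub>p u\<close> is almost as good an approximate eigenvector as \<open>u\<close>.
\<close>

lemma singular_localization:
  assumes a: "bounded_bonds a" and w: "bounded (range w)" and e: "e > 0"
    and sing: "singular_at_infinity UNIV (jacobi_op a w)"
  shows "\<exists>Q. finite Q \<and> (\<forall>F. finite F \<longrightarrow> (\<exists>p u. u \<noteq> 0 \<and> (\<forall>n. coord u n \<noteq> 0 \<longrightarrow> n - p \<in> Q)
    \<and> (\<forall>n\<in>F. coord u n = 0) \<and> norm (jacobi_op a w u) \<le> e * norm u))"
proof -
  define D where "D = (unit_steps :: (int ^ 'a) set)"
  define H where "H = jacobi_op a w"
  obtain C0 where C0: "\<And>m n. adjacent m n \<Longrightarrow> \<bar>a {n, m}\<bar> \<le> C0"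
    using a by (auto simp: bounded_bonds_def)
  define C where "C = max C0 0"
  have C: "\<bar>a {n, n + d}\<bar> \<le> C" "0 \<le> C" if "d \<in> D" for n d
    using C0[of "n + d" n] that by (auto simp: C_def D_def)
  \<comment> \<open>One factor \<open>card D\<close> comes from Cauchy-Schwarz in the sum over
    steps, the other from adding up the resulting bounds. The next constant \<delta> limits the
    commutators to a quarter of the square of \<open>e\<close>; its summand 1 keeps the denominator
    positive.\<close>
  define c0 where "c0 = (real (card D))\<^sup>2 * C\<^sup>2"
  define \<delta> where "\<delta> = e\<^sup>2 / (4 * (c0 + 1))"
  have c0: "0 \<le> c0" by (simp add: c0_def)
  have \<delta>: "\<delta> > 0" "c0 * \<delta> \<le> e\<^sup>2 / 4"
    using e c0 by (auto simp: \<delta>_def field_simps)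
  obtain k where k: "\<forall>d\<in>D. finite {m. (m + d \<in> cube k) \<noteq> (m \<in> cube k)} \<and>
      real (card {m. (m + d \<in> cube k) \<noteq> (m \<in> cube k)}) \<le> \<delta> * real (card (cube k :: (int ^ 'a) set))"
    using cube_Folner[OF \<delta>(1)] unfolding D_def by blast
  define Q where "Q = (cube k :: (int ^ 'a) set)"
  define N where "N = real (card Q)"
  have Q: "finite Q"
    by (simp add: Q_def finite_cube)
  have N: "N > 0"
    by (simp add: N_def Q_def card_cube)
  have "\<exists>p x. x \<noteq> 0 \<and> (\<forall>n. coord x n \<noteq> 0 \<longrightarrow> n - p \<in> Q) \<and> (\<forall>n\<in>F. coord x n = 0)
      \<and> norm (H x) \<le> e * norm x" if F: "finite F" for F
  proof -
    have "e / 2 > 0" using e by simp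
    then obtain u where u: "u \<noteq> 0" "\<forall>n\<in>F. coord u n = 0" "finite {n. coord u n \<noteq> 0}"
      "norm (H u) < e / 2 * norm u"
      using sing F unfolding singular_at_infinity_def H_def by blast
    define U where "U = {n. coord u n \<noteq> 0}"
    define M where "M = U \<union> (\<Union>d\<in>D. (\<lambda>q. q - d) ` U)"
    have U: "finite U" and M: "finite M"
      using u(3) finite_unit_steps by (auto simp: U_def M_def D_def)
    have out: "coord u n = 0" "d \<in> D \<Longrightarrow> coord u (n + d) = 0" if "n \<notin> M" for n d
      using that by (force simp: M_def U_def image_iff)+
    \<comment> \<open>Exactly the p for which p + Q meets the support of \<open>u\<close>, so that
      summing over all translates is a finite sum.\<close>
    define P where "P = (\<lambda>(n, q). n - q) ` (U \<times> Q)"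
    have P: "finite P"
      using U Q by (simp add: P_def)
    define R where "R p = restr {n. n - p \<in> Q}" for p
    define \<beta> where "\<beta> d m \<longleftrightarrow> (m + d \<in> Q) \<noteq> (m \<in> Q)" for d m
    define K where "K p = H (R p u) - R p (H u)" for p

    have coord_H: "coord (H x) n = (\<Sum>d\<in>D. of_real (a {n, n + d}) * coord x (n + d)) + w n * coord x n" for x n
      unfolding H_def D_def by (rule coord_jacobi_op[OF a w])
    \<comment> \<open>The potential commutes with the cutoff and drops out; a step contributes only
      where it crosses the boundary of p + Q, which is what \<beta> records.\<close>
    have coord_K: "coord (K p) n = (\<Sum>d\<in>D. of_real (a {n, n + d})
        * ((of_bool (n + d - p \<in> Q) - of_bool (n - p \<in> Q)) * coord u (n + d)))" for p n
    proof -
      have R: "coord (R p x) m = of_bool (m - p \<in> Q) * coord x m" for x m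
        by (simp add: R_def)
      have "coord (K p) n
          = (\<Sum>d\<in>D. of_real (a {n, n + d}) * (of_bool (n + d - p \<in> Q) * coord u (n + d)))
            - of_bool (n - p \<in> Q) * (\<Sum>d\<in>D. of_real (a {n, n + d}) * coord u (n + d))"
        unfolding K_def coord_simps R coord_H by (simp add: distrib_left mult.left_commute)
      then show ?thesis
        by (simp add: sum_distrib_left sum_subtractf left_diff_distrib right_diff_distrib
            mult.left_commute)
    qed
    have K_le: "(cmod (coord (K p) n))\<^sup>2
        \<le> real (card D) * (\<Sum>d\<in>D. C\<^sup>2 * (if \<beta> d (n - p) then (cmod (coord u (n + d)))\<^sup>2 else 0))" for p n
    proof -
      have "(cmod (coord (K p) n))\<^sup>2 \<le> real (card D) * (\<Sum>d\<in>D. (cmod (of_real (a {n, n + d})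
          * ((of_bool (n + d - p \<in> Q) - of_bool (n - p \<in> Q)) * coord u (n + d))))\<^sup>2)"
        unfolding coord_K by (rule cmod_sum_squared_le)
      also have "\<dots> \<le> real (card D) * (\<Sum>d\<in>D. C\<^sup>2 * (if \<beta> d (n - p) then (cmod (coord u (n + d)))\<^sup>2 else 0))"
      proof (intro mult_left_mono sum_mono)
        fix d assume d: "d \<in> D"
        have "(of_bool (n + d - p \<in> Q) - of_bool (n - p \<in> Q) :: complex)
            = (if \<beta> d (n - p) then (if n - p \<in> Q then - 1 else 1) else 0)"
          by (auto simp: \<beta>_def algebra_simps)
        then have "(cmod (of_real (a {n, n + d})
            * ((of_bool (n + d - p \<in> Q) - of_bool (n - p \<in> Q)) * coord u (n + d))))\<^sup>2
            = \<bar>a {n, n + d}\<bar>\<^sup>2 * (if \<beta> d (n - p) then (cmod (coord u (n + d)))\<^sup>2 else 0)"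
          by (simp add: norm_mult power_mult_distrib)
        also have "\<dots> \<le> C\<^sup>2 * (if \<beta> d (n - p) then (cmod (coord u (n + d)))\<^sup>2 else 0)"
          using C(1)[OF d, of n] by (intro mult_right_mono power_mono) auto
        finally show "(cmod (of_real (a {n, n + d})
            * ((of_bool (n + d - p \<in> Q) - of_bool (n - p \<in> Q)) * coord u (n + d))))\<^sup>2
            \<le> C\<^sup>2 * (if \<beta> d (n - p) then (cmod (coord u (n + d)))\<^sup>2 else 0)" .
      qed simp
      finally show ?thesis .
    qed
    have sum_K: "(\<Sum>p\<in>P. (norm (K p))\<^sup>2) \<le> c0 * \<delta> * N * (norm u)\<^sup>2"
    proof -
      have "(norm (K p))\<^sup>2 = (\<Sum>n\<in>M. (cmod (coord (K p) n))\<^sup>2)" for p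
        by (rule norm_l2_finite_support[OF M]) (simp add: coord_K out)
      then have "(\<Sum>p\<in>P. (norm (K p))\<^sup>2) \<le> (\<Sum>p\<in>P. \<Sum>n\<in>M. real (card D) *
          (\<Sum>d\<in>D. C\<^sup>2 * (if \<beta> d (n - p) then (cmod (coord u (n + d)))\<^sup>2 else 0)))"
        by (simp add: sum_mono K_le)
      also have "\<dots> = (\<Sum>d\<in>D. \<Sum>n\<in>M. real (card D) * C\<^sup>2 *
          (\<Sum>p\<in>P. if \<beta> d (n - p) then (cmod (coord u (n + d)))\<^sup>2 else 0))"
        unfolding sum_distrib_left mult.assoc by (rule sum_swap3)
      also have "\<dots> \<le> (\<Sum>d\<in>D. \<Sum>n\<in>M. real (card D) * C\<^sup>2 * (\<delta> * N * (cmod (coord u (n + d)))\<^sup>2))"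
      proof (intro sum_mono mult_left_mono)
        fix d n assume d: "d \<in> D"
        define Y where "Y = {m. \<beta> d m}"
        have Y: "finite Y" "real (card Y) \<le> \<delta> * N"
          using k d by (simp_all add: Y_def \<beta>_def Q_def N_def)
        have "card {p\<in>P. \<beta> d (n - p)} \<le> card {p. n - p \<in> Y}"
          using card_translates(2)[OF Y(1)] by (intro card_mono) (auto simp: Y_def)
        then have "real (card {p\<in>P. \<beta> d (n - p)}) \<le> \<delta> * N"
          using Y(2) card_translates(1)[OF Y(1), of n] by linarith
        then show "(\<Sum>p\<in>P. if \<beta> d (n - p) then (cmod (coord u (n + d)))\<^sup>2 else 0)
            \<le> \<delta> * N * (cmod (coord u (n + d)))\<^sup>2"
          unfolding sum_if_card[OF P] by (intro mult_right_mono) auto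
      qed simp
      also have "\<dots> = (\<Sum>d\<in>D. real (card D) * C\<^sup>2 * \<delta> * N * (\<Sum>n\<in>M. (cmod (coord (transl d u) n))\<^sup>2))"
        by (simp add: sum_distrib_left mult_ac)
      also have "\<dots> \<le> (\<Sum>d\<in>D. real (card D) * C\<^sup>2 * \<delta> * N * (norm (transl d u))\<^sup>2)"
        using \<delta>(1) N by (intro sum_mono mult_left_mono sum_coord_sq_le M) auto
      also have "\<dots> = c0 * \<delta> * N * (norm u)\<^sup>2"
        by (simp add: c0_def power2_eq_square mult_ac)
      finally show ?thesis .
    qed
    \<comment> \<open>Only an upper bound here: \<open>P\<close> is built from the support of
      \<open>u\<close>, whereas \<open>H u\<close> may reach one step further.\<close>
    have sum_RH: "(\<Sum>p\<in>P. (norm (R p (H u)))\<^sup>2) \<le> N * (norm (H u))\<^sup>2"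
    proof -
      have Hout: "coord (H u) n = 0" if "n \<notin> M" for n
        using out[OF that] by (simp add: coord_H)
      have "(\<Sum>p\<in>P. (norm (R p (H u)))\<^sup>2) = (\<Sum>p\<in>P. \<Sum>n\<in>M. if n - p \<in> Q then (cmod (coord (H u) n))\<^sup>2 else 0)"
        by (intro sum.cong refl, subst norm_l2_finite_support[OF M])
           (auto simp: R_def Hout intro!: sum.cong)
      also have "\<dots> = (\<Sum>n\<in>M. real (card {p\<in>P. n - p \<in> Q}) * (cmod (coord (H u) n))\<^sup>2)"
        by (subst sum.swap) (simp add: sum_if_card[OF P])
      also have "\<dots> \<le> (\<Sum>n\<in>M. N * (cmod (coord (H u) n))\<^sup>2)"
      proof (intro sum_mono mult_right_mono)
        fix n
        have "card {p\<in>P. n - p \<in> Q} \<le> card {p. n - p \<in> Q}"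
          using card_translates(2)[OF Q] by (intro card_mono) auto
        then show "real (card {p\<in>P. n - p \<in> Q}) \<le> N"
          by (simp add: N_def card_translates(1)[OF Q])
      qed simp
      also have "\<dots> \<le> N * (norm (H u))\<^sup>2"
        unfolding sum_distrib_left[symmetric] using N by (intro mult_left_mono sum_coord_sq_le M) auto
      finally show ?thesis .
    qed
    have sum_R: "(\<Sum>p\<in>P. (norm (R p u))\<^sup>2) = N * (norm u)\<^sup>2"
    proof -
      have "(\<Sum>p\<in>P. (norm (R p u))\<^sup>2) = (\<Sum>p\<in>P. \<Sum>n\<in>U. if n - p \<in> Q then (cmod (coord u n))\<^sup>2 else 0)"
        by (intro sum.cong refl, subst norm_l2_finite_support[OF U])
           (auto simp: R_def U_def intro!: sum.cong)
      also have "\<dots> = (\<Sum>n\<in>U. real (card {p\<in>P. n - p \<in> Q}) * (cmod (coord u n))\<^sup>2)"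
        by (subst sum.swap) (simp add: sum_if_card[OF P])
      also have "\<dots> = (\<Sum>n\<in>U. N * (cmod (coord u n))\<^sup>2)"
      proof (intro sum.cong refl)
        fix n assume n: "n \<in> U"
        have "p \<in> P" if "n - p \<in> Q" for p
        proof -
          have "n - (n - p) \<in> P"
            unfolding P_def using n that by blast
          then show ?thesis by simp
        qed
        then have "{p\<in>P. n - p \<in> Q} = {p. n - p \<in> Q}" by auto
        then show "real (card {p\<in>P. n - p \<in> Q}) * (cmod (coord u n))\<^sup>2 = N * (cmod (coord u n))\<^sup>2"
          by (simp add: N_def card_translates(1)[OF Q])
      qed
      also have "\<dots> = N * (norm u)\<^sup>2"
        by (subst norm_l2_finite_support[OF U]) (auto simp: U_def sum_distrib_left)
      finally show ?thesis .
    qed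
    have HR: "(norm (H (R p u)))\<^sup>2 \<le> 2 * (norm (R p (H u)))\<^sup>2 + 2 * (norm (K p))\<^sup>2" for p
    proof -
      have "norm (H (R p u)) \<le> norm (R p (H u)) + norm (K p)"
        using norm_triangle_ineq[of "R p (H u)" "K p"] by (simp add: K_def)
      then have "(norm (H (R p u)))\<^sup>2 \<le> (norm (R p (H u)) + norm (K p))\<^sup>2"
        by (intro power_mono) auto
      also have "\<dots> \<le> 2 * (norm (R p (H u)))\<^sup>2 + 2 * (norm (K p))\<^sup>2"
        using zero_le_power2[of "norm (R p (H u)) - norm (K p)"] by (simp add: power2_sum power2_diff)
      finally show ?thesis .
    qed
    have "(\<Sum>p\<in>P. (norm (H (R p u)))\<^sup>2) \<le> (\<Sum>p\<in>P. 2 * (norm (R p (H u)))\<^sup>2 + 2 * (norm (K p))\<^sup>2)"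
      by (intro sum_mono HR)
    also have "\<dots> = 2 * (\<Sum>p\<in>P. (norm (R p (H u)))\<^sup>2) + 2 * (\<Sum>p\<in>P. (norm (K p))\<^sup>2)"
      by (simp add: sum.distrib sum_distrib_left)
    also have "\<dots> \<le> 2 * (N * (norm (H u))\<^sup>2) + 2 * (c0 * \<delta> * N * (norm u)\<^sup>2)"
      using sum_RH sum_K by linarith
    \<comment> \<open>Both summands come to half of \<open>e\<^sup>2 * N * (norm u)\<^sup>2\<close>:
      the first from the factor e/2 in the choice of \<open>u\<close>, the second from the choice of
      \<delta>.\<close>
    also have "\<dots> < 2 * (N * (e / 2 * norm u)\<^sup>2) + 2 * (e\<^sup>2 / 4 * N * (norm u)\<^sup>2)"
    proof -
      have "(norm (H u))\<^sup>2 < (e / 2 * norm u)\<^sup>2"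
        using u(4) by (intro power_strict_mono) auto
      then have "N * (norm (H u))\<^sup>2 < N * (e / 2 * norm u)\<^sup>2"
        using N by simp
      moreover have "c0 * \<delta> * N * (norm u)\<^sup>2 \<le> e\<^sup>2 / 4 * N * (norm u)\<^sup>2"
        using \<delta>(2) N by (intro mult_right_mono) auto
      ultimately show ?thesis by linarith
    qed
    also have "\<dots> = e\<^sup>2 * (\<Sum>p\<in>P. (norm (R p u))\<^sup>2)"
      unfolding sum_R by (simp add: power_mult_distrib power_divide field_simps)
    finally have lt: "(\<Sum>p\<in>P. (norm (H (R p u)))\<^sup>2) < (\<Sum>p\<in>P. e\<^sup>2 * (norm (R p u))\<^sup>2)"
      by (simp add: sum_distrib_left)
    \<comment> \<open>Strict inequality between the sums must be strict at some \<open>p\<close>,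
      and strictness there already forces \<open>R p u\<close> to be nonzero.\<close>
    have "\<not> (\<forall>p\<in>P. e\<^sup>2 * (norm (R p u))\<^sup>2 \<le> (norm (H (R p u)))\<^sup>2)"
      using lt sum_mono[of P "\<lambda>p. e\<^sup>2 * (norm (R p u))\<^sup>2" "\<lambda>p. (norm (H (R p u)))\<^sup>2"]
      unfolding not_le[symmetric] by blast
    then obtain p where p: "p \<in> P" "(norm (H (R p u)))\<^sup>2 < e\<^sup>2 * (norm (R p u))\<^sup>2"
      by (auto simp: not_le)
    have "R p u \<noteq> 0"
    proof
      assume "R p u = 0"
      then have "(norm (H (R p u)))\<^sup>2 < e\<^sup>2 * 0\<^sup>2"
        using p(2) by (simp only: norm_zero)
      then show False
        using zero_le_power2[of "norm (H (R p u))"] unfolding power_zero_numeral mult_zero_right by linarith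
    qed
    moreover have "norm (H (R p u)) \<le> e * norm (R p u)"
    proof (rule power2_le_imp_le)
      show "(norm (H (R p u)))\<^sup>2 \<le> (e * norm (R p u))\<^sup>2"
        unfolding power_mult_distrib using p(2) by linarith
    qed (use e in simp)
    ultimately show ?thesis
      using u(2) by (intro exI[of _ p] exI[of _ "R p u"]) (auto simp: R_def)
  qed
  with Q show ?thesis
    unfolding H_def by blast
qed


section \<open>Extraction of limit points by compactness\<close>

lemma lattice_vec_diff: "lattice_vec (m - n) = lattice_vec m - lattice_vec n"
  by (simp add: lattice_vec_def vec_eq_iff)

lemma not_in_cube_norm:
  assumes "n \<notin> cube k"
  shows "real k \<le> norm (lattice_vec n)"
proof -
  obtain i where "int k < \<bar>n $ i\<bar>"
    using assms by (auto simp: cube_def not_le)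
  then have "real k \<le> \<bar>real_of_int (n $ i)\<bar>"
    by linarith
  also have "\<dots> \<le> norm (lattice_vec n)"
    using component_le_norm_cart[of "lattice_vec n" i] by (simp add: lattice_vec_def)
  finally show ?thesis .
qed

text \<open>
  Everything that has to converge along the subsequence is collected into one bounded family with
  a countable index set.
\<close>

lemma limit_point_compactness:
  fixes p :: "nat \<Rightarrow> int ^ 'n" and v :: "nat \<Rightarrow> int ^ 'n \<Rightarrow> complex"
  assumes a: "bounded_bonds a" and b: "bounded (range b)"
    and p: "filterlim (\<lambda>j. norm (lattice_vec (p j))) at_top sequentially"
    and v: "\<And>j m. cmod (v j m) \<le> 1"
  obtains r e a' b' v' where "strict_mono (r :: nat \<Rightarrow> nat)" "norm e = 1" "jacobi a' b' \<in> limit_points a b e"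
    "\<And>l. (\<lambda>j. b (p (r j) + l)) \<longlonglongrightarrow> b' l"
    "\<And>k l. adjacent k l \<Longrightarrow> (\<lambda>j. a {p (r j) + l, p (r j) + k}) \<longlonglongrightarrow> a' {k, l}"
    "\<And>m. (\<lambda>j. v (r j) m) \<longlonglongrightarrow> v' m"
proof -
  define q where "q j = lattice_vec (p j) /\<^sub>R norm (lattice_vec (p j))" for j
  obtain A where A: "\<And>m n. adjacent m n \<Longrightarrow> \<bar>a {n, m}\<bar> \<le> A"
    using a by (auto simp: bounded_bonds_def)
  obtain B where B: "\<And>n. \<bar>b n\<bar> \<le> B"
    using b by (auto simp: bounded_iff)
  \<comment> \<open>The four kinds of index are bonds, sites, coordinates of the vectors and
    components of the direction; real quantities are embedded into the complex numbers.\<close>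
  define f :: "nat \<Rightarrow> ((int ^ 'n) set + int ^ 'n) + (int ^ 'n + 'n) \<Rightarrow> complex" where
    "f j x = (case x of
        Inl (Inl s) \<Rightarrow> of_real (a ((+) (p j) ` s))
      | Inl (Inr l) \<Rightarrow> of_real (b (p j + l))
      | Inr (Inl m) \<Rightarrow> v j m
      | Inr (Inr i) \<Rightarrow> of_real (q j $ i))" for j x
  \<comment> \<open>Restricting to bonds gives countability, which fails for all sets of lattice
    points, and boundedness, which is known for \<open>a\<close> on bonds only.\<close>
  define X where "X = {{k, l} | k l :: int ^ 'n. adjacent k l}"
  define S where "S = (X <+> (UNIV :: (int ^ 'n) set)) <+> ((UNIV :: (int ^ 'n) set) <+> (UNIV :: 'n set))"
  have "X \<subseteq> (\<lambda>(k, l). {k, l}) ` UNIV"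
    by (auto simp: X_def)
  then have "countable X"
    by (rule countable_subset) (intro countable_image countableI_type)
  then have "countable S"
    by (auto simp: S_def Plus_def)
  have S_in: "Inl (Inr l) \<in> S" "Inr (Inl l) \<in> S" "Inr (Inr i) \<in> S" "s \<in> X \<Longrightarrow> Inl (Inl s) \<in> S" for l i s
    by (auto simp: S_def)
  have q1: "norm (q j) \<le> 1" for j
    by (simp add: q_def divide_simps)
  have bound: "norm (f j x) \<le> max (max A B) 1" if "x \<in> S" for j x
  proof -
    have "\<bar>a ((+) (p j) ` {k, l})\<bar> \<le> A" if "adjacent k l" for k l
      using A[of "p j + k" "p j + l"] that by (simp add: adjacent_iff_unit_steps insert_commute)
    moreover have "\<bar>q j $ i\<bar> \<le> 1" for i
      using component_le_norm_cart[of "q j" i] q1[of j] by linarith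
    ultimately show ?thesis
      using that v[of j] B
      by (auto simp: S_def X_def f_def le_max_iff_disj split: sum.splits)
  qed
  obtain r where r: "strict_mono (r :: nat \<Rightarrow> nat)" "\<And>x. x \<in> S \<Longrightarrow> \<exists>l. (\<lambda>j. f (r j) x) \<longlonglongrightarrow> l"
    using function_convergent_subsequence[OF \<open>countable S\<close>, of f "max (max A B) 1"] bound by blast
  define L where "L x = lim (\<lambda>j. f (r j) x)" for x
  have L: "(\<lambda>j. f (r j) x) \<longlonglongrightarrow> L x" if "x \<in> S" for x
    using r(2)[OF that] by (simp add: L_def convergent_def flip: convergent_LIMSEQ_iff)
  define a' where "a' s = Re (L (Inl (Inl s)))" for s
  define b' where "b' l = Re (L (Inl (Inr l)))" for l
  define v' where "v' m = L (Inr (Inl m))" for m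
  define e where "e = (\<chi> i. Re (L (Inr (Inr i))))"
  have lim_b: "(\<lambda>j. b (p (r j) + l)) \<longlonglongrightarrow> b' l" for l
    using tendsto_Re[OF L[OF S_in(1)[of l]]] by (simp add: b'_def f_def)
  have lim_a: "(\<lambda>j. a {p (r j) + l, p (r j) + k}) \<longlonglongrightarrow> a' {k, l}" if "adjacent k l" for k l
  proof -
    have kl: "{k, l} \<in> X"
      using that by (auto simp: X_def)
    show ?thesis
      using tendsto_Re[OF L[OF S_in(4)[OF kl]]] by (simp add: a'_def f_def insert_commute)
  qed
  have lim_v: "(\<lambda>j. v (r j) m) \<longlonglongrightarrow> v' m" for m
    using L[OF S_in(2)[of m]] by (simp add: v'_def f_def)
  have lim_q: "(\<lambda>j. q (r j)) \<longlonglongrightarrow> e"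
  proof (rule vec_tendstoI)
    show "(\<lambda>j. q (r j) $ i) \<longlonglongrightarrow> e $ i" for i
      using tendsto_Re[OF L[OF S_in(3)[of i]]] by (simp add: e_def f_def)
  qed
  have pr: "filterlim (\<lambda>j. norm (lattice_vec (p (r j)))) at_top sequentially"
    using filterlim_compose[OF p filterlim_subseq[OF r(1)]] .
  have "norm e = 1"
  proof (rule LIMSEQ_unique)
    show "(\<lambda>j. norm (q (r j))) \<longlonglongrightarrow> norm e"
      by (intro tendsto_norm lim_q)
    \<comment> \<open>Where \<open>p\<close> vanishes, division by zero makes \<open>q\<close> zero
      too, so unit length holds only eventually.\<close>
    have "\<forall>\<^sub>F j in sequentially. 0 < norm (lattice_vec (p (r j)))"
      using pr unfolding filterlim_at_top_dense by blast
    then have "\<forall>\<^sub>F j in sequentially. norm (q (r j)) = 1"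
      by (rule eventually_mono) (simp add: q_def)
    then show "(\<lambda>j. norm (q (r j))) \<longlonglongrightarrow> 1"
      by (rule tendsto_eventually)
  qed
  moreover have "jacobi a' b' \<in> limit_points a b e"
    unfolding limit_points_def mem_Collect_eq
    by (rule exI[of _ a'], rule exI[of _ b'], intro conjI refl exI[of _ "\<lambda>j. p (r j)"] allI impI)
       (use pr lim_q lim_b lim_a in \<open>auto simp: q_def\<close>)
  ultimately show thesis
    using r(1) lim_b lim_a lim_v by (intro that[of r e a' b' v'])
qed

text \<open>Brought back to the origin, all the localized vectors live on the same finite
  \<open>Q\<close>, so a subsequence converges in norm to a unit vector. It is an approximate null
  vector of a limit point, with error \<epsilon>/2.\<close>

lemma singular_imp_closure_limit_spectra:
  fixes a :: "(int ^ 'n) set \<Rightarrow> real"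
  assumes a: "bounded_bonds a" and b: "bounded (range b)"
    and sing: "singular_at_infinity UNIV (jacobi_op a (\<lambda>n. of_real (b n) - z))"
  shows "z \<in> closure (\<Union>e \<in> sphere (0 :: real ^ 'n) 1. \<Union>T \<in> limit_points a b e. spectrum T)"
  unfolding closure_approachable
proof (intro allI impI)
  fix \<epsilon> :: real assume \<epsilon>: "\<epsilon> > 0"
  define G where "G = jacobi_op a (\<lambda>n. of_real (b n) - z)"
  have real_z: "z = of_real (Re z)"
    using singular_jacobi_imp_real[OF a b sing] by (simp add: complex_eq_iff)
  have G: "bounded_linear G"
    unfolding G_def by (rule bounded_linear_jacobi_op[OF a bounded_range_shift[OF b]])
  obtain Q where Q: "finite Q" and loc: "\<forall>F. finite F \<longrightarrow> (\<exists>p u. u \<noteq> 0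
      \<and> (\<forall>n. coord u n \<noteq> 0 \<longrightarrow> n - p \<in> Q) \<and> (\<forall>n\<in>F. coord u n = 0) \<and> norm (G u) \<le> \<epsilon> / 2 * norm u)"
    using singular_localization[OF a bounded_range_shift[OF b] half_gt_zero[OF \<epsilon>] sing]
    unfolding G_def by (elim exE conjE)
  \<comment> \<open>The last clause records that the original vector vanished on
    \<open>cube j\<close>; as \<open>Q\<close> does not depend on \<open>j\<close>, it drives the
    centres \<open>p j\<close> to infinity.\<close>
  have "\<exists>p u. norm u = 1 \<and> (\<forall>m. m \<notin> Q \<longrightarrow> coord u m = 0) \<and> norm (G (transl (- p) u)) \<le> \<epsilon> / 2
      \<and> (\<exists>q\<in>Q. p + q \<notin> cube j)" for j
  proof -
    obtain p u where u: "u \<noteq> 0" "\<forall>n. coord u n \<noteq> 0 \<longrightarrow> n - p \<in> Q" "\<forall>n\<in>cube j. coord u n = 0"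
      "norm (G u) \<le> \<epsilon> / 2 * norm u"
      using loc finite_cube[of j] by blast
    define x where "x = (1 / norm u) *\<^sub>R u"
    have "norm (transl p x) = 1"
      using u(1) by (simp add: x_def)
    moreover have "\<forall>m. m \<notin> Q \<longrightarrow> coord (transl p x) m = 0"
    proof (intro allI impI)
      fix m assume "m \<notin> Q"
      then show "coord (transl p x) m = 0"
        using u(2)[rule_format, of "m + p"] by (auto simp: x_def)
    qed
    moreover have "norm (G (transl (- p) (transl p x))) \<le> \<epsilon> / 2"
      using u(1,4) by (simp add: x_def linear_scale[OF bounded_linear.linear[OF G]] field_simps)
    moreover have "\<exists>q\<in>Q. p + q \<notin> cube j"
    proof -
      obtain n where n: "coord u n \<noteq> 0"
        using u(1) l2_eqI[of u 0] by auto
      then have "n \<notin> cube j" "n - p \<in> Q"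
        using u(2,3) by auto
      then show ?thesis
        by (intro bexI[of _ "n - p"]) auto
    qed
    ultimately show ?thesis
      by blast
  qed
  then obtain p u where pu: "\<And>j. norm (u j) = 1" "\<And>j m. m \<notin> Q \<Longrightarrow> coord (u j) m = 0"
    "\<And>j. norm (G (transl (- p j) (u j))) \<le> \<epsilon> / 2" "\<And>j. \<exists>q\<in>Q. p j + q \<notin> cube j"
    by metis
  define r0 where "r0 = (\<Sum>q\<in>Q. norm (lattice_vec q))"
  have "real j - r0 \<le> norm (lattice_vec (p j))" for j
  proof -
    obtain q where q: "q \<in> Q" "p j + q \<notin> cube j"
      using pu(4) by blast
    have "norm (lattice_vec q) \<le> r0"
      unfolding r0_def using q(1) Q by (intro member_le_sum) auto
    moreover have "lattice_vec (p j) = lattice_vec (p j + q) - lattice_vec q"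
      by (simp flip: lattice_vec_diff)
    then have "norm (lattice_vec (p j + q)) - norm (lattice_vec q) \<le> norm (lattice_vec (p j))"
      using norm_triangle_ineq2 by metis
    ultimately show ?thesis
      using not_in_cube_norm[OF q(2)] by linarith
  qed
  then have p: "filterlim (\<lambda>j. norm (lattice_vec (p j))) at_top sequentially"
    by (intro filterlim_at_top_mono[of "\<lambda>j. - r0 + real j", OF filterlim_tendsto_add_at_top
        [OF tendsto_const filterlim_real_sequentially]] always_eventually) (simp add: algebra_simps)
  have u1: "cmod (coord (u j) m) \<le> 1" for j m
    using cmod_coord_le[of "u j" m] pu(1)[of j] by simp
  obtain r e a' b' v' where r: "strict_mono (r :: nat \<Rightarrow> nat)" and e: "norm e = 1"
    and T: "jacobi a' b' \<in> limit_points a b e"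
    and lim_b: "\<And>l. (\<lambda>j. b (p (r j) + l)) \<longlonglongrightarrow> b' l"
    and lim_a: "\<And>k l. adjacent k l \<Longrightarrow> (\<lambda>j. a {p (r j) + l, p (r j) + k}) \<longlonglongrightarrow> a' {k, l}"
    and lim_v: "\<And>m. (\<lambda>j. coord (u (r j)) m) \<longlonglongrightarrow> v' m"
    using limit_point_compactness[OF a b p, of "\<lambda>j. coord (u j)"] u1 by blast
  have bd': "bounded_bonds a'" "bounded (range b')"
    using bounded_limit_coefficients[OF a b lim_b lim_a] by auto
  define x where "x = (\<Sum>m\<in>Q. cscale (v' m) (unit_vec m))"
  have coord_x: "coord x m = (if m \<in> Q then v' m else 0)" for m
    using Q by (simp add: x_def coord_sum if_distrib sum.delta cong: if_cong)
  have lim_x: "(\<lambda>j. coord (u (r j)) m) \<longlonglongrightarrow> coord x m" for m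
    using lim_v[of m] pu(2)[of m] by (simp add: coord_x)
  define S where "S = jacobi_op a' (\<lambda>n. of_real (b' n) - z)"
  have "(\<lambda>j. norm (G (transl (- p (r j)) (u (r j))))) \<longlonglongrightarrow> norm (S x)"
    unfolding G_def S_def
    by (rule norm_jacobi_op_translates_tendsto[OF a b lim_b lim_a Q _ _ lim_x])
       (use pu(2) in \<open>auto simp: coord_x\<close>)
  then have Sx: "norm (S x) \<le> \<epsilon> / 2"
    using pu(3) by (intro Lim_bounded[of _ _ 0]) auto
  have "(norm x)\<^sup>2 = 1"
  proof (rule LIMSEQ_unique)
    have "(norm x)\<^sup>2 = (\<Sum>m\<in>Q. (cmod (coord x m))\<^sup>2)"
      by (rule norm_l2_finite_support[OF Q]) (simp add: coord_x)
    moreover have "(\<lambda>j. \<Sum>m\<in>Q. (cmod (coord (u (r j)) m))\<^sup>2) \<longlonglongrightarrow> (\<Sum>m\<in>Q. (cmod (coord x m))\<^sup>2)"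
      by (intro tendsto_intros lim_x)
    moreover have "(\<Sum>m\<in>Q. (cmod (coord (u (r j)) m))\<^sup>2) = 1" for j
      using norm_l2_finite_support[OF Q, of "u (r j)"] pu(1,2) by simp
    ultimately show "(\<lambda>j. 1) \<longlonglongrightarrow> (norm x)\<^sup>2"
      by simp
  qed simp
  then have x: "norm x = 1"
    using norm_ge_zero[of x] unfolding power2_eq_1_iff by linarith
  have S: "bounded_linear S"
    unfolding S_def by (rule bounded_linear_jacobi_op[OF bd'(1) bounded_range_shift[OF bd'(2)]])
  have cnj_z: "cnj z = z"
    by (subst (1 2) real_z) simp
  have sym: "S y \<bullet> y' = y \<bullet> S y'" for y y'
    using inner_jacobi_op[OF bd'(1) bounded_range_shift[OF bd'(2)], of z] by (simp add: S_def cnj_z)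
  \<comment> \<open>\<open>z\<close> is real, so \<open>S\<close> is symmetric, and its approximate
    kernel yields a spectral point of the limit operator at distance at most \<epsilon>/2 from
    \<open>z\<close>.\<close>
  obtain t where t: "\<bar>t\<bar> \<le> \<epsilon> / 2" "\<not> bounded_below (\<lambda>y. S y - t *\<^sub>R y)"
    by (rule approx_kernel_imp_not_bounded_below[OF S sym, of x "\<epsilon> / 2"]) (use x Sx in auto)
  have "z + of_real t \<in> spectrum (jacobi a' b')"
  proof -
    have "jacobi_op a' (\<lambda>n. of_real (b' n) - (z + of_real t)) = (\<lambda>y. S y - t *\<^sub>R y)"
      by (rule ext) (simp only: jacobi_op_shift_const[OF bd'] S_def scaleR_eq_cscale)
    then show ?thesis
      using t(2) by (simp add: spectrum_jacobi[OF bd'])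
  qed
  moreover have "dist (z + of_real t) z < \<epsilon>"
    using t(1) \<epsilon> by (simp add: dist_norm)
  ultimately show "\<exists>y\<in>(\<Union>e \<in> sphere (0 :: real ^ 'n) 1. \<Union>T \<in> limit_points a b e. spectrum T). dist y z < \<epsilon>"
    using T e by (intro bexI[of _ "z + of_real t"]) auto
qed

theorem theorem3p6:
  fixes a :: "(int ^ 'n) set \<Rightarrow> real" and b :: "int ^ 'n \<Rightarrow> real"
  assumes a_nonzero: "\<And>m n. adjacent m n \<Longrightarrow> a {n, m} \<noteq> 0"
    and a_bounded: "bdd_above {\<bar>a {n, m}\<bar> + inverse \<bar>a {n, m}\<bar> | m n. adjacent m n}"
    and b_bounded: "bdd_above {\<bar>b n\<bar> | n. True}"
  shows "essential_spectrum (jacobi a b) =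
    closure (\<Union>e \<in> sphere (0 :: real ^ 'n) 1. \<Union>T \<in> limit_points a b e. spectrum T)"
proof -
  obtain A where A: "\<And>m n. adjacent m n \<Longrightarrow> \<bar>a {n, m}\<bar> + inverse \<bar>a {n, m}\<bar> \<le> A"
    using a_bounded unfolding bdd_above_def by blast
  have "\<bar>a {n, m}\<bar> \<le> A" if "adjacent m n" for m n
  proof -
    have "0 \<le> inverse \<bar>a {n, m}\<bar>" by simp
    with A[OF that] show ?thesis by linarith
  qed
  then have a: "bounded_bonds a"
    by (auto simp: bounded_bonds_def)
  have b: "bounded (range b)"
    using b_bounded by (auto simp: bdd_above_def bounded_iff)
  show ?thesis
    using essential_spectrum_jacobi[OF a b] closure_limit_spectra_imp_singular[OF a b]
      singular_imp_closure_limit_spectra[OF a b] by blast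
qed

end
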